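(* Let $t=(\mathcal{G},\sigma,\Omega)$ be a symplectic symmetric triple such that $\mathcal{G}$ is neither solvable nor semisimple, with canonical decomposition $\mathcal{G}=\mathcal{K}\oplus\mathcal{P}$. Let $\mathcal{R}$ be the radical of $\mathcal{G}$, $\mathcal{P}_{\mathcal{R}}=\mathcal{P}\cap\mathcal{R}$, and let $\mathcal{L}$ be the Lie algebra of the maximal semisimple factor of $t$. If $\mathcal{P}_{\mathcal{R}}$ is symplectic (i.e. $\Omega$ restricts non-degenerately to $\mathcal{P}_{\mathcal{R}}$), then $\mathcal{L}$ is a Levi factor of $\mathcal{G}$.
   Context: A symplectic symmetric triple is a triple $t=(\mathcal{G},\sigma,\Omega)$ where: (i) $\mathcal{G}$ is a finite-dimensional real Lie algebra; (ii) $\sigma$ is an involutive automorphism of $\mathcal{G}$ such that, writing $\mathcal{G}=\mathcal{K}\oplus\mathcal{P}$ with $\sigma=\mathrm{id}_{\mathcal{K}}\oplus(-\mathrm{id}_{\mathcal{P}})$ (canonical decomposition), one has $[\mathcal{P},\mathcal{P}]=\mathcal{K}$ and $\mathcal{K}$ acts faithfully on $\mathcal{P}$; (iii) $\Omega$ is a $\mathcal{K}$-invariant symplectic form on $\mathcal{P}$. Direct sums of triples are defined in the obvious way (with orthogonal direct sum of forms). If $t=t_{\mathcal{L}}\oplus t_1$ with $t_{\mathcal{L}}=(\mathcal{L},\sigma|_{\mathcal{L}},\Omega_{\mathcal{L}})$ a triple with $\mathcal{L}$ semisimple, $t_{\mathcal{L}}$ is a semisimple factor of $t$; it is maximal if $t_1$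 has no non-zero semisimple factor. Every symplectic symmetric triple $t=(\mathcal{G},\sigma,\Omega)$ such that $\mathcal{G}$ is neither solvable nor semisimple has a unique maximal semisimple factor (possibly zero), whose Lie algebra is denoted $\mathcal{L}$. *)

theory Defs
  imports Complex_Main
begin

text \<open>
  A finite-dimensional real Lie algebra is a finite-dimensional subspace \<open>G\<close> of an ambient real
  vector space with a bracket \<open>br\<close>. Everything is relativised to \<open>G\<close>, so that subalgebras, ideals
  and direct summands are Lie algebras for the same \<open>br\<close>; \<open>br\<close> is unconstrained outside \<open>G\<close>.
\<close>

definition linear_on_set :: "'a::real_vector set \<Rightarrow> ('a \<Rightarrow> 'b::real_vector) \<Rightarrow> bool" where
  "linear_on_set V f \<longleftrightarrow>
     (\<forall>x\<in>V. \<forall>y\<in>V. f (x + y) = f x + f y) \<and> (\<forall>c. \<forall>x\<in>V. f (c *\<^sub>R x) = c *\<^sub>R f x)"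

definition bilinear_on_set :: "'a::real_vector set \<Rightarrow> ('a \<Rightarrow> 'a \<Rightarrow> 'b::real_vector) \<Rightarrow> bool" where
  "bilinear_on_set V f \<longleftrightarrow>
     (\<forall>y\<in>V. linear_on_set V (\<lambda>x. f x y)) \<and> (\<forall>x\<in>V. linear_on_set V (f x))"

locale lie_algebra =
  fixes G :: "'a::real_vector set" and br :: "'a \<Rightarrow> 'a \<Rightarrow> 'a"
  assumes subspace_carrier: "subspace G"
    and finite_dimensional: "\<exists>B. finite B \<and> G \<subseteq> span B"
    and bracket_closed: "\<And>x y. x \<in> G \<Longrightarrow> y \<in> G \<Longrightarrow> br x y \<in> G"
    and bracket_bilinear: "bilinear_on_set G br"
    and bracket_alternating: "\<And>x. x \<in> G \<Longrightarrow> br x x = 0"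
    and jacobi: "\<And>x y z. x \<in> G \<Longrightarrow> y \<in> G \<Longrightarrow> z \<in> G \<Longrightarrow>
                   br x (br y z) + br y (br z x) + br z (br x y) = 0"

definition lie_ideal :: "'a::real_vector set \<Rightarrow> ('a \<Rightarrow> 'a \<Rightarrow> 'a) \<Rightarrow> 'a set \<Rightarrow> bool" where
  "lie_ideal G br I \<longleftrightarrow> subspace I \<and> I \<subseteq> G \<and> (\<forall>x\<in>G. \<forall>y\<in>I. br x y \<in> I)"

definition lie_subalgebra :: "'a::real_vector set \<Rightarrow> ('a \<Rightarrow> 'a \<Rightarrow> 'a) \<Rightarrow> 'a set \<Rightarrow> bool" where
  "lie_subalgebra G br H \<longleftrightarrow> subspace H \<and> H \<subseteq> G \<and> (\<forall>x\<in>H. \<forall>y\<in>H. br x y \<in> H)"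

definition bracket_span :: "('a::real_vector \<Rightarrow> 'a \<Rightarrow> 'a) \<Rightarrow> 'a set \<Rightarrow> 'a set \<Rightarrow> 'a set" where
  "bracket_span br A B = span {br x y | x y. x \<in> A \<and> y \<in> B}"

primrec derived_series :: "('a::real_vector \<Rightarrow> 'a \<Rightarrow> 'a) \<Rightarrow> 'a set \<Rightarrow> nat \<Rightarrow> 'a set" where
  "derived_series br G 0 = G"
| "derived_series br G (Suc n) = bracket_span br (derived_series br G n) (derived_series br G n)"

definition lie_solvable :: "'a::real_vector set \<Rightarrow> ('a \<Rightarrow> 'a \<Rightarrow> 'a) \<Rightarrow> bool" where
  "lie_solvable G br \<longleftrightarrow> (\<exists>n. derived_series br G n = {0})"

text \<open>
  The radical is defined as the sum of all solvable ideals; \<open>lie_radical_solvable_ideal\<close> and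
  \<open>lie_radical_greatest\<close> below show that it is the greatest solvable ideal.
\<close>

definition lie_radical :: "'a::real_vector set \<Rightarrow> ('a \<Rightarrow> 'a \<Rightarrow> 'a) \<Rightarrow> 'a set" where
  "lie_radical G br = span (\<Union>{I. lie_ideal G br I \<and> lie_solvable I br})"

text \<open>The zero Lie algebra is both solvable and semisimple.\<close>

definition lie_semisimple :: "'a::real_vector set \<Rightarrow> ('a \<Rightarrow> 'a \<Rightarrow> 'a) \<Rightarrow> bool" where
  "lie_semisimple G br \<longleftrightarrow> lie_radical G br = {0}"

definition internal_direct_sum :: "'a::real_vector set \<Rightarrow> 'a set \<Rightarrow> 'a set \<Rightarrow> bool" where
  "internal_direct_sum V A B \<longleftrightarrow> A \<inter> B = {0} \<and> V = {a + b | a b. a \<in> A \<and> b \<in> B}"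

definition levi_factor :: "'a::real_vector set \<Rightarrow> ('a \<Rightarrow> 'a \<Rightarrow> 'a) \<Rightarrow> 'a set \<Rightarrow> bool" where
  "levi_factor G br L \<longleftrightarrow>
     lie_subalgebra G br L \<and> lie_semisimple L br \<and> internal_direct_sum G L (lie_radical G br)"

definition symplectic_on :: "'a::real_vector set \<Rightarrow> ('a \<Rightarrow> 'a \<Rightarrow> real) \<Rightarrow> bool" where
  "symplectic_on V \<Omega> \<longleftrightarrow>
     bilinear_on_set V \<Omega> \<and> (\<forall>x\<in>V. \<Omega> x x = 0) \<and>
     (\<forall>x\<in>V. (\<forall>y\<in>V. \<Omega> x y = 0) \<longrightarrow> x = 0)"

definition fixed_part :: "('a::real_vector \<Rightarrow> 'a) \<Rightarrow> 'a set \<Rightarrow> 'a set" where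
  "fixed_part \<sigma> G = {x \<in> G. \<sigma> x = x}"

definition anti_part :: "('a::real_vector \<Rightarrow> 'a) \<Rightarrow> 'a set \<Rightarrow> 'a set" where
  "anti_part \<sigma> G = {x \<in> G. \<sigma> x = - x}"

text \<open>
  In the canonical decomposition, \<open>\<K>\<close> is \<open>fixed_part \<sigma> G\<close> and \<open>\<P>\<close> is \<open>anti_part \<sigma> G\<close>.
  The form \<open>\<Omega>\<close> matters only on \<open>anti_part \<sigma> G\<close>. The zero triple is allowed.
\<close>

locale symplectic_symmetric_triple = lie_algebra G br
  for G :: "'a::real_vector set" and br :: "'a \<Rightarrow> 'a \<Rightarrow> 'a" +
  fixes \<sigma> :: "'a \<Rightarrow> 'a" and \<Omega> :: "'a \<Rightarrow> 'a \<Rightarrow> real"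
  assumes sigma_closed: "\<And>x. x \<in> G \<Longrightarrow> \<sigma> x \<in> G"
    and sigma_linear: "linear_on_set G \<sigma>"
    and sigma_bracket: "\<And>x y. x \<in> G \<Longrightarrow> y \<in> G \<Longrightarrow> \<sigma> (br x y) = br (\<sigma> x) (\<sigma> y)"
    and sigma_involutive: "\<And>x. x \<in> G \<Longrightarrow> \<sigma> (\<sigma> x) = x"
    and bracket_anti_part:
      "bracket_span br (anti_part \<sigma> G) (anti_part \<sigma> G) = fixed_part \<sigma> G"
    and faithful:
      "\<And>k. k \<in> fixed_part \<sigma> G \<Longrightarrow> (\<forall>p\<in>anti_part \<sigma> G. br k p = 0) \<Longrightarrow> k = 0"
    and symplectic: "symplectic_on (anti_part \<sigma> G) \<Omega>"
    and invariant:
      "\<And>k x y. k \<in> fixed_part \<sigma> G \<Longrightarrow> x \<in> anti_part \<sigma> G \<Longrightarrow> y \<in> anti_part \<sigma> G \<Longrightarrow>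
         \<Omega> (br k x) y + \<Omega> x (br k y) = 0"

text \<open>
  Internal direct sum of triples: both summands carry the restrictions of \<open>\<sigma>\<close> and \<open>\<Omega>\<close>, they
  commute, and their anti-invariant parts are \<open>\<Omega>\<close>-orthogonal.
\<close>

definition triple_direct_sum ::
  "'a::real_vector set \<Rightarrow> ('a \<Rightarrow> 'a \<Rightarrow> 'a) \<Rightarrow> ('a \<Rightarrow> 'a) \<Rightarrow> ('a \<Rightarrow> 'a \<Rightarrow> real) \<Rightarrow>
     'a set \<Rightarrow> 'a set \<Rightarrow> bool" where
  "triple_direct_sum G br \<sigma> \<Omega> A B \<longleftrightarrow>
     symplectic_symmetric_triple G br \<sigma> \<Omega> \<and>
     symplectic_symmetric_triple A br \<sigma> \<Omega> \<and>
     symplectic_symmetric_triple B br \<sigma> \<Omega> \<and>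
     internal_direct_sum G A B \<and>
     (\<forall>a\<in>A. \<forall>b\<in>B. br a b = 0) \<and>
     (\<forall>x\<in>anti_part \<sigma> A. \<forall>y\<in>anti_part \<sigma> B. \<Omega> x y = 0)"

definition semisimple_factor ::
  "'a::real_vector set \<Rightarrow> ('a \<Rightarrow> 'a \<Rightarrow> 'a) \<Rightarrow> ('a \<Rightarrow> 'a) \<Rightarrow> ('a \<Rightarrow> 'a \<Rightarrow> real) \<Rightarrow>
     'a set \<Rightarrow> bool" where
  "semisimple_factor G br \<sigma> \<Omega> L \<longleftrightarrow>
     (\<exists>G1. triple_direct_sum G br \<sigma> \<Omega> L G1 \<and> lie_semisimple L br)"

definition maximal_semisimple_factor ::
  "'a::real_vector set \<Rightarrow> ('a \<Rightarrow> 'a \<Rightarrow> 'a) \<Rightarrow> ('a \<Rightarrow> 'a) \<Rightarrow> ('a \<Rightarrow> 'a \<Rightarrow> real) \<Rightarrow>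
     'a set \<Rightarrow> bool" where
  "maximal_semisimple_factor G br \<sigma> \<Omega> L \<longleftrightarrow>
     (\<exists>G1. triple_direct_sum G br \<sigma> \<Omega> L G1 \<and> lie_semisimple L br \<and>
           (\<forall>M. semisimple_factor G1 br \<sigma> \<Omega> M \<longrightarrow> M = {0}))"


lemma bracket_span_mono:
  "A \<subseteq> A' \<Longrightarrow> B \<subseteq> B' \<Longrightarrow> bracket_span br A B \<subseteq> bracket_span br A' B'"
  unfolding bracket_span_def by (rule span_mono) blast

lemma derived_series_mono: "A \<subseteq> B \<Longrightarrow> derived_series br A n \<subseteq> derived_series br B n"
  by (induction n) (auto intro: bracket_span_mono[THEN subsetD])

lemma derived_series_add: "derived_series br A (n + m) = derived_series br (derived_series br A n) m"
  by (induction m) simp_all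

lemma subspace_derived_series: "subspace A \<Longrightarrow> subspace (derived_series br A n)"
  by (cases n) (simp_all add: bracket_span_def)

context lie_algebra
begin

lemma bracket_add_left:
  "x \<in> G \<Longrightarrow> y \<in> G \<Longrightarrow> z \<in> G \<Longrightarrow> br (x + y) z = br x z + br y z"
  using bracket_bilinear by (simp add: bilinear_on_set_def linear_on_set_def)

lemma bracket_add_right:
  "x \<in> G \<Longrightarrow> y \<in> G \<Longrightarrow> z \<in> G \<Longrightarrow> br x (y + z) = br x y + br x z"
  using bracket_bilinear by (simp add: bilinear_on_set_def linear_on_set_def)

lemma bracket_skew:
  assumes "x \<in> G" "y \<in> G"
  shows "br x y = - br y x"
proof -
  have "x + y \<in> G" using assms subspace_carrier by (simp add: subspace_add)
  then have "br (x + y) (x + y) = br x x + br y x + (br x y + br y y)"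
    using assms by (simp add: bracket_add_left bracket_add_right)
  then have "br x y + br y x = 0"
    using assms \<open>x + y \<in> G\<close> by (simp add: bracket_alternating add.commute)
  then show ?thesis by (simp add: eq_neg_iff_add_eq_0)
qed

lemma bracket_ideal_right:
  assumes "lie_ideal G br I" "x \<in> I" "y \<in> G"
  shows "br x y \<in> I"
proof -
  have "br y x \<in> I" "x \<in> G" "subspace I" using assms by (auto simp: lie_ideal_def)
  then show ?thesis using bracket_skew[of x y] assms(3) by (simp add: subspace_neg)
qed

lemma lie_ideal_sum:
  assumes I: "lie_ideal G br I" and J: "lie_ideal G br J"
  shows "lie_ideal G br {a + b | a b. a \<in> I \<and> b \<in> J}"
proof -
  have sub: "subspace I" "subspace J" "I \<subseteq> G" "J \<subseteq> G" using I J by (auto simp: lie_ideal_def)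
  have "br x (a + b) = br x a + br x b \<and> br x a \<in> I \<and> br x b \<in> J"
    if "x \<in> G" "a \<in> I" "b \<in> J" for x a b
    using that sub I J by (auto simp: lie_ideal_def intro!: bracket_add_right)
  then have "\<forall>x\<in>G. \<forall>y\<in>{a + b | a b. a \<in> I \<and> b \<in> J}. br x y \<in> {a + b | a b. a \<in> I \<and> b \<in> J}"
    by blast
  moreover have "{a + b | a b. a \<in> I \<and> b \<in> J} \<subseteq> G"
    using sub subspace_carrier by (auto intro!: subspace_add)
  ultimately show ?thesis
    using subspace_sums[OF sub(1,2)] by (simp add: lie_ideal_def)
qed

lemma derived_series_subset:
  assumes "subspace A" "A \<subseteq> G" "\<forall>x\<in>A. \<forall>y\<in>A. br x y \<in> A"
  shows "derived_series br A n \<subseteq> A"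
proof (induction n)
  case (Suc n)
  then have "{br x y | x y. x \<in> derived_series br A n \<and> y \<in> derived_series br A n} \<subseteq> A"
    using assms(3) by blast
  then show ?case using assms(1) by (simp add: bracket_span_def span_minimal)
qed simp

lemma lie_solvable_sum:
  assumes I: "lie_ideal G br I" "lie_solvable I br" and J: "lie_ideal G br J" "lie_solvable J br"
  shows "lie_solvable {a + b | a b. a \<in> I \<and> b \<in> J} br"
proof -
  let ?S = "{a + b | a b. a \<in> I \<and> b \<in> J}"
  have sub: "subspace I" "subspace J" "I \<subseteq> G" "J \<subseteq> G" using I J by (auto simp: lie_ideal_def)
  have I_sub: "derived_series br I n \<subseteq> I" for n
    using I(1) sub by (intro derived_series_subset) (auto simp: lie_ideal_def)
  have step: "derived_series br ?S n \<subseteq> {a + b | a b. a \<in> derived_series br I n \<and> b \<in> J}" for n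
  proof (induction n)
    case (Suc n)
    let ?D = "derived_series br I"
    have "br (a + b) (a' + b') \<in> {a + b | a b. a \<in> ?D (Suc n) \<and> b \<in> J}"
      if "a \<in> ?D n" "b \<in> J" "a' \<in> ?D n" "b' \<in> J" for a b a' b'
    proof -
      have G: "a \<in> G" "b \<in> G" "a' \<in> G" "b' \<in> G" using that I_sub sub by blast+
      have G': "a' + b' \<in> G" using G subspace_carrier by (simp add: subspace_add)
      have 1: "br (a + b) (a' + b') = br a a' + (br a b' + br b (a' + b'))"
        using G G' by (simp add: bracket_add_left bracket_add_right)
      have 2: "br a a' \<in> ?D (Suc n)"
        unfolding derived_series.simps bracket_span_def by (rule span_base) (use that in blast)
      have 3: "br a b' + br b (a' + b') \<in> J"
      proof (rule subspace_add[OF sub(2)])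
        show "br a b' \<in> J" using J(1) G that by (auto simp: lie_ideal_def)
        show "br b (a' + b') \<in> J" using bracket_ideal_right[OF J(1) \<open>b \<in> J\<close> G'] .
      qed
      show ?thesis using 1 2 3 by blast
    qed
    then have "{br x y | x y. x \<in> derived_series br ?S n \<and> y \<in> derived_series br ?S n}
        \<subseteq> {a + b | a b. a \<in> ?D (Suc n) \<and> b \<in> J}"
      using Suc by blast
    moreover have "subspace {a + b | a b. a \<in> ?D (Suc n) \<and> b \<in> J}"
      by (intro subspace_sums subspace_derived_series sub)
    ultimately show ?case
      unfolding derived_series.simps(2)[of br ?S] bracket_span_def[of br "derived_series br ?S n"]
      by (rule span_minimal)
  qed simp
  obtain n m where n: "derived_series br I n = {0}" and m: "derived_series br J m = {0}"
    using I(2) J(2) by (auto simp: lie_solvable_def)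
  have "derived_series br ?S n \<subseteq> J" using step[of n] n by auto
  then have "derived_series br ?S (n + m) \<subseteq> {0}"
    unfolding derived_series_add using derived_series_mono m by blast
  moreover have "0 \<in> derived_series br ?S (n + m)"
    by (intro subspace_0 subspace_derived_series subspace_sums sub)
  ultimately have "derived_series br ?S (n + m) = {0}" by blast
  then show ?thesis unfolding lie_solvable_def by blast
qed

lemma greatest_solvable_ideal_exists:
  obtains M where "lie_ideal G br M" "lie_solvable M br"
    "\<And>J. lie_ideal G br J \<Longrightarrow> lie_solvable J br \<Longrightarrow> J \<subseteq> M"
proof -
  obtain B where B: "finite B" "G \<subseteq> span B" using finite_dimensional by blast
  define Q where "Q n \<longleftrightarrow> (\<exists>I C. lie_ideal G br I \<and> lie_solvable I br \<and> C \<subseteq> I \<and>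
    independent C \<and> finite C \<and> card C = n)" for n
  have zero: "lie_ideal G br {0}" 
  proof -
    have "br x 0 = 0" if "x \<in> G" for x
      using bracket_add_right[of x 0 0] that subspace_carrier by (simp add: subspace_0)
    then show ?thesis using subspace_carrier by (auto simp: lie_ideal_def subspace_0)
  qed
  have "lie_solvable {0} br"
    unfolding lie_solvable_def by (rule exI[of _ 0]) simp
  then have "Q 0" using zero unfolding Q_def
    by (intro exI[of _ "{0}"] exI[of _ "{}"]) (auto simp: independent_empty)
  moreover have bound: "n \<le> card B" if "Q n" for n
  proof -
    from that obtain I C where "C \<subseteq> I" "lie_ideal G br I" "independent C" "card C = n"
      unfolding Q_def by blast
    moreover from this have "C \<subseteq> span B" using B by (auto simp: lie_ideal_def)
    ultimately show ?thesis using independent_span_bound[OF B(1)] by blast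
  qed
  ultimately obtain n where n: "Q n" "\<And>k. Q k \<Longrightarrow> k \<le> n"
    using Nat.ex_has_greatest_nat[of Q 0 "card B"] by blast
  then obtain I C where I: "lie_ideal G br I" "lie_solvable I br"
    and C: "C \<subseteq> I" "independent C" "finite C" "card C = n"
    unfolding Q_def by blast
  have "J \<subseteq> I" if J: "lie_ideal G br J" "lie_solvable J br" for J
  proof
    fix x assume x: "x \<in> J"
    have sub: "subspace I" "subspace J" using I J by (auto simp: lie_ideal_def)
    show "x \<in> I"
    proof (rule ccontr)
      assume "x \<notin> I"
      moreover have "span C \<subseteq> I" using C sub by (simp add: span_minimal)
      ultimately have xC: "x \<notin> span C" by blast
      let ?S = "{a + b | a b. a \<in> I \<and> b \<in> J}"
      have "c \<in> ?S" if "c \<in> C" for c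
        using that C(1) subspace_0[OF sub(2)] by (intro CollectI exI[of _ c] exI[of _ 0]) auto
      moreover have "x \<in> ?S"
        using x subspace_0[OF sub(1)] by (intro CollectI exI[of _ 0] exI[of _ x]) auto
      ultimately have "insert x C \<subseteq> ?S" by blast
      moreover have "independent (insert x C)" using xC C(2) by (rule independent_insertI)
      moreover have "card (insert x C) = Suc n" using xC C by (metis card_insert_disjoint span_base)
      ultimately have "Q (Suc n)"
        unfolding Q_def using lie_ideal_sum[OF I(1) J(1)] lie_solvable_sum[OF I J] C(3)
        by (intro exI[of _ ?S] exI[of _ "insert x C"]) auto
      then show False using n(2) by fastforce
    qed
  qed
  then show thesis using that I by blast
qed

lemma
  shows lie_radical_solvable_ideal: "lie_ideal G br (lie_radical G br)"
      "lie_solvable (lie_radical G br) br"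
    and lie_radical_greatest: "lie_ideal G br J \<Longrightarrow> lie_solvable J br \<Longrightarrow> J \<subseteq> lie_radical G br"
proof -
  obtain M where M: "lie_ideal G br M" "lie_solvable M br"
    "\<And>J. lie_ideal G br J \<Longrightarrow> lie_solvable J br \<Longrightarrow> J \<subseteq> M"
    using greatest_solvable_ideal_exists by blast
  then have "\<Union>{I. lie_ideal G br I \<and> lie_solvable I br} = M" by blast
  then have "lie_radical G br = M"
    using M(1) by (simp add: lie_radical_def lie_ideal_def span_eq_iff)
  then show "lie_ideal G br (lie_radical G br)" "lie_solvable (lie_radical G br) br"
    "lie_ideal G br J \<Longrightarrow> lie_solvable J br \<Longrightarrow> J \<subseteq> lie_radical G br"
    using M by auto
qed

end

end

theory Submission
  imports Defs
begin

text \<open>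
  Write \<open>R\<close> for the radical, \<open>K\<close> and \<open>P\<close> for the invariant and anti-invariant parts. Split
  \<open>G = L \<oplus> H\<close> with \<open>H\<close> free of semisimple factors. Since \<open>L\<close> is semisimple, \<open>H\<close> contains the
  radical of \<open>G\<close> and has the same radical (\<open>direct_sum_radical\<close>), so \<open>H\<close> again has a symplectic
  \<open>P \<inter> R\<close>. It suffices to show that a triple with symplectic \<open>P \<inter> R\<close> splits as a direct sum
  \<open>S \<oplus> R\<close> of triples with \<open>S\<close> semisimple: for \<open>H\<close> this forces \<open>S = 0\<close>, hence \<open>H = R\<close> and
  \<open>G = L \<oplus> R\<close>.

  The candidate is \<open>S = W + [W, W]\<close>, where \<open>W\<close> is the \<open>\<Omega>\<close>-orthogonal complement of \<open>P \<inter> R\<close> in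
  \<open>P\<close>. Both \<open>W\<close> and \<open>P \<inter> R\<close> are \<open>K\<close>-stable, so \<open>K \<inter> R\<close> maps \<open>W\<close> into \<open>W \<inter> R = 0\<close>; with the
  Jacobi identity this makes \<open>[W, W]\<close> commute with \<open>R\<close>. It follows that \<open>S\<close> is a subalgebra
  complementary to \<open>R\<close>, hence semisimple. What remains is \<open>[W, P \<inter> R] = 0\<close>. For \<open>x, y, y'\<close> in
  \<open>P \<inter> R\<close> the functional \<open>w \<mapsto> \<Omega>([[w, x], y], y')\<close> on \<open>W\<close> is invariant under \<open>[W, W]\<close>, so it is
  represented by some \<open>z \<in> W\<close> that commutes with \<open>[W, W]\<close>. Then \<open>[z, [z, s]] = 0\<close> for every
  \<open>s \<in> S\<close>: \<open>z\<close> is a sandwich element of \<open>S\<close>. Once \<open>z = 0\<close> is known, all these functionals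
  vanish, so \<open>[w, x]\<close> acts trivially on \<open>P \<inter> R\<close>, as it does on \<open>W\<close>, and is zero by faithfulness.

  The key fact is therefore that a Lie algebra with zero radical has no sandwich element except
  \<open>0\<close> (\<open>sandwich_eq_zero\<close>). It is proved without the Killing form. Sandwich elements are closed
  under the bracket, so by an argument in the style of Engel and Jacobson their span acts
  nilpotently (\<open>sandwich_span_nilpotent\<close>). The flow of any inner derivation consists of
  automorphisms and preserves sandwich elements; differentiating it shows that their span is an
  ideal (\<open>sandwich_span_ideal\<close>). This solvable ideal must vanish.
\<close>

section \<open>Linear algebra on finite-dimensional subspaces\<close>

lemma linear_on_set_diff:
  assumes "linear_on_set V f" "subspace V" "x \<in> V" "y \<in> V"
  shows "f (x - y) = f x - f y"
proof -
  have "f (x + (-1) *\<^sub>R y) = f x + f ((-1) *\<^sub>R y)"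
    using assms subspace_scale[of V y "-1"] unfolding linear_on_set_def by blast
  also have "f ((-1) *\<^sub>R y) = (-1) *\<^sub>R f y"
    using assms unfolding linear_on_set_def by blast
  finally show ?thesis by simp
qed

lemma linear_on_set_zero:
  assumes "linear_on_set V f" "subspace V"
  shows "f 0 = 0"
  using linear_on_set_diff[OF assms, of 0 0] subspace_0[OF assms(2)] by simp

lemma linear_on_set_sum:
  assumes f: "linear_on_set V f" and V: "subspace V" and S: "\<And>i. i \<in> S \<Longrightarrow> g i \<in> V"
  shows "f (\<Sum>i\<in>S. h i *\<^sub>R g i) = (\<Sum>i\<in>S. h i *\<^sub>R f (g i))"
proof (cases "finite S")
  case True
  then show ?thesis using S
  proof (induction S rule: finite_induct)
    case empty
    then show ?case using linear_on_set_zero[OF f V] by simp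
  next
    case (insert i S)
    have "(\<Sum>i\<in>S. h i *\<^sub>R g i) \<in> V" "h i *\<^sub>R g i \<in> V"
      using insert V by (auto intro!: subspace_sum subspace_scale)
    then have "f (h i *\<^sub>R g i + (\<Sum>i\<in>S. h i *\<^sub>R g i)) = f (h i *\<^sub>R g i) + f (\<Sum>i\<in>S. h i *\<^sub>R g i)"
      using f unfolding linear_on_set_def by blast
    moreover have "f (h i *\<^sub>R g i) = h i *\<^sub>R f (g i)"
      using f insert unfolding linear_on_set_def by blast
    ultimately show ?case using insert by simp
  qed
qed (simp add: linear_on_set_zero[OF f V])

lemma linear_on_set_vimage_subspace:
  assumes "linear_on_set V f" "subspace V" "subspace U"
  shows "subspace {x \<in> V. f x \<in> U}"
  using assms linear_on_set_zero[OF assms(1,2)]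
  unfolding subspace_def linear_on_set_def by auto

lemma linear_on_set_span:
  assumes "linear_on_set V f" "subspace V" "subspace U" "A \<subseteq> V" "\<And>a. a \<in> A \<Longrightarrow> f a \<in> U" "x \<in> span A"
  shows "f x \<in> U"
proof -
  have "span A \<subseteq> {x \<in> V. f x \<in> U}"
    using assms by (intro span_minimal linear_on_set_vimage_subspace) auto
  then show ?thesis using assms by blast
qed

lemma linear_on_set_image_subspace:
  assumes f: "linear_on_set V f" and V: "subspace V"
  shows "subspace (f ` V)"
  unfolding subspace_def
proof (intro conjI ballI allI)
  show "0 \<in> f ` V" using linear_on_set_zero[OF f V] subspace_0[OF V] by force
  fix x assume "x \<in> f ` V"
  then obtain u where u: "u \<in> V" "x = f u" by blast
  show "c *\<^sub>R x \<in> f ` V" for c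
  proof (rule image_eqI)
    show "c *\<^sub>R x = f (c *\<^sub>R u)" using f u by (simp add: linear_on_set_def)
  qed (use u V in \<open>simp add: subspace_scale\<close>)
  fix y assume "y \<in> f ` V"
  then obtain v where v: "v \<in> V" "y = f v" by blast
  show "x + y \<in> f ` V"
  proof (rule image_eqI)
    show "x + y = f (u + v)" using f u v by (simp add: linear_on_set_def)
  qed (use u v V in \<open>simp add: subspace_add\<close>)
qed

text \<open>
  A member of largest dimension is maximal; the ambient space itself may be infinite-dimensional.
\<close>

lemma maximal_subspace_exists:
  fixes P :: "'a::real_vector set \<Rightarrow> bool"
  assumes "finite F" "P U" and sub: "\<And>V. P V \<Longrightarrow> subspace V \<and> V \<subseteq> span F"
  obtains V where "P V" "\<And>V'. P V' \<Longrightarrow> V \<subseteq> V' \<Longrightarrow> V' = V"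
proof -
  have bound: "\<forall>V. P V \<longrightarrow> dim V < Suc (card F)"
    using sub dim_le_card[OF _ assms(1)] by (simp add: less_Suc_eq_le)
  have "\<exists>V. P V \<and> (\<forall>V'. P V' \<longrightarrow> dim V' \<le> dim V)"
    by (rule Lattices_Big.ex_has_greatest_nat[OF assms(2) bound])
  then obtain V where V: "P V" "\<And>V'. P V' \<Longrightarrow> dim V' \<le> dim V" by blast
  have "V' \<subseteq> V" if V': "P V'" "V \<subseteq> V'" for V'
  proof
    fix x assume x: "x \<in> V'"
    obtain C where C: "C \<subseteq> V" "independent C" "V \<subseteq> span C" "card C = dim V"
      using basis_exists by blast
    obtain C' where C': "C' \<subseteq> V'" "independent C'" "V' \<subseteq> span C'" "card C' = dim V'"
      using basis_exists by blast
    have "C \<subseteq> span F" "C' \<subseteq> span F"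
      using C(1) C'(1) sub[OF V(1)] sub[OF V'(1)] by auto
    then have fin: "finite C" "finite C'"
      using independent_span_bound[OF assms(1)] C(2) C'(2) by auto
    show "x \<in> V"
    proof (rule ccontr)
      assume "x \<notin> V"
      then have "x \<notin> span C" using span_minimal[OF C(1)] sub[OF V(1)] by blast
      moreover from this have "x \<notin> C" by (auto simp: span_base)
      ultimately have "independent (insert x C)" "card (insert x C) = Suc (dim V)"
        using C(2,4) fin(1) by (auto simp: independent_insertI)
      moreover have "insert x C \<subseteq> span C'" using x C(1) C'(3) V'(2) by auto
      ultimately show False
        using independent_span_bound[OF fin(2), of "insert x C"] C'(4) V(2)[OF V'(1)] by simp
    qed
  qed
  then show thesis using that[OF V(1)] by (simp add: subset_antisym)
qed

lemma bilinear_on_set_subset: "bilinear_on_set V f \<Longrightarrow> U \<subseteq> V \<Longrightarrow> bilinear_on_set U f"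
  unfolding bilinear_on_set_def linear_on_set_def by blast

lemma linear_on_set_subset: "linear_on_set V f \<Longrightarrow> U \<subseteq> V \<Longrightarrow> linear_on_set U f"
  unfolding linear_on_set_def by blast

lemma basis_expansion:
  assumes "independent B" "finite B" "x \<in> span B"
  shows "(\<Sum>b\<in>B. representation B x b *\<^sub>R b) = x"
proof -
  have "(\<Sum>b | representation B x b \<noteq> 0. representation B x b *\<^sub>R b) = (\<Sum>b\<in>B. representation B x b *\<^sub>R b)"
    using assms by (intro sum.mono_neutral_left) (auto dest: representation_ne_zero)
  then show ?thesis using sum_nonzero_representation_eq[OF assms(1,3)] by simp
qed

lemma linear_on_set_representation:
  assumes "independent B"
  shows "linear_on_set (span B) (\<lambda>x. representation B x b)"
  using assms by (simp add: linear_on_set_def representation_add representation_scale)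

lemma representation_combination:
  assumes "independent B" "finite B" "b \<in> B"
  shows "representation B (\<Sum>b\<in>B. s b *\<^sub>R b) b = s b"
proof -
  have "representation B (\<Sum>b\<in>B. s b *\<^sub>R b) b = (\<Sum>b'\<in>B. s b' *\<^sub>R representation B b' b)"
    by (rule linear_on_set_sum[OF linear_on_set_representation[OF assms(1)] subspace_span])
       (rule span_base)
  also have "\<dots> = (\<Sum>b'\<in>B. if b' = b then s b else 0)"
    by (intro sum.cong refl) (simp add: representation_basis[OF assms(1)])
  finally show ?thesis using assms by simp
qed

text \<open>
  The map that sends \<open>x\<close> to the values \<open>\<Omega> x b\<close> on a basis is injective, hence, by counting
  dimensions, it reaches the values of any prescribed functional.
\<close>

lemma nondegenerate_form_represents:
  fixes \<Omega> :: "'a::real_vector \<Rightarrow> 'a \<Rightarrow> real"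
  assumes V: "subspace V" "V \<subseteq> span F" "finite F"
    and \<Omega>: "bilinear_on_set V \<Omega>" and nondeg: "\<And>x. x \<in> V \<Longrightarrow> \<forall>y\<in>V. \<Omega> x y = 0 \<Longrightarrow> x = 0"
    and f: "linear_on_set V f"
  obtains q where "q \<in> V" "\<And>v. v \<in> V \<Longrightarrow> \<Omega> q v = f v"
proof -
  obtain B where B: "B \<subseteq> V" "independent B" "V \<subseteq> span B"
    using maximal_independent_subset by blast
  have VB: "V = span B" using B(3) span_minimal[OF B(1) V(1)] by blast
  have fin: "finite B" using independent_span_bound[OF V(3) B(2)] B(1) V(2) by blast
  define T where "T x = (\<Sum>b\<in>B. \<Omega> x b *\<^sub>R b)" for x
  have \<Omega>_left: "linear_on_set V (\<lambda>x. \<Omega> x y)" if "y \<in> V" for y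
    using \<Omega> that by (simp add: bilinear_on_set_def)
  have \<Omega>_right: "linear_on_set V (\<Omega> x)" if "x \<in> V" for x
    using \<Omega> that by (simp add: bilinear_on_set_def)
  have eq_on_basis: "g x = h x" if "linear_on_set V g" "linear_on_set V h" "x \<in> V"
    "\<And>b. b \<in> B \<Longrightarrow> g b = h b" for g h :: "'a \<Rightarrow> real" and x
  proof -
    have expand: "g' (\<Sum>b\<in>B. representation B x b *\<^sub>R b) = (\<Sum>b\<in>B. representation B x b *\<^sub>R g' b)"
      if "linear_on_set V g'" for g' :: "'a \<Rightarrow> real"
      using B(1) by (intro linear_on_set_sum[OF that V(1)]) auto
    have "(\<Sum>b\<in>B. representation B x b *\<^sub>R b) = x"
      using basis_expansion[OF B(2) fin] that(3) VB by simp
    then show ?thesis using expand[OF that(1)] expand[OF that(2)] that(4) by simp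
  qed
  have T_lin: "linear_on_set V T"
    using \<Omega>_left B(1) unfolding T_def linear_on_set_def
    by (auto simp: sum.distrib scaleR_add_left scaleR_sum_right subset_iff)
  have zero_lin: "linear_on_set V (\<lambda>_. 0::real)" by (simp add: linear_on_set_def)
  have T_inj: "x = 0" if "x \<in> V" "T x = 0" for x
  proof (rule nondeg[OF that(1)], rule ballI)
    fix y assume y: "y \<in> V"
    have "\<Omega> x b = 0" if "b \<in> B" for b
      using representation_combination[OF B(2) fin that, of "\<Omega> x"] \<open>T x = 0\<close>
      by (simp add: T_def representation_zero)
    then show "\<Omega> x y = 0" by (intro eq_on_basis[OF \<Omega>_right[OF \<open>x \<in> V\<close>] zero_lin y])
  qed
  have T_inj_on: "inj_on T V"
  proof (rule inj_onI)
    fix x y assume "x \<in> V" "y \<in> V" "T x = T y"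
    then have "x - y \<in> V" "T (x - y) = 0"
      using linear_on_set_diff[OF T_lin V(1)] V(1) by (auto simp: subspace_diff)
    then show "x = y" using T_inj by fastforce
  qed
  have TV: "T x \<in> V" for x unfolding VB T_def by (intro span_sum span_scale span_base)
  have indep: "independent (T ` B)"
  proof
    assume "dependent (T ` B)"
    then obtain u v where u: "v \<in> B" "u (T v) \<noteq> 0" "(\<Sum>v\<in>T ` B. u v *\<^sub>R v) = 0"
      using dependent_finite[of "T ` B"] fin by auto
    have "inj_on T B" using T_inj_on B(1) by (rule inj_on_subset)
    then have "0 = (\<Sum>b\<in>B. u (T b) *\<^sub>R T b)" using u(3) by (simp add: sum.reindex)
    also have "\<dots> = T (\<Sum>b\<in>B. u (T b) *\<^sub>R b)"
      using B(1) by (intro linear_on_set_sum[OF T_lin V(1), symmetric]) auto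
    finally have "(\<Sum>b\<in>B. u (T b) *\<^sub>R b) = 0"
      using T_inj VB by (simp add: span_sum span_scale span_base)
    then have "dependent B"
      unfolding dependent_finite[OF fin] using u(1,2) by (intro exI[of _ "\<lambda>b. u (T b)"]) auto
    then show False using B(2) by simp
  qed
  have card: "card (T ` B) = card B"
    using T_inj_on B(1) by (intro card_image) (rule inj_on_subset)
  define w where "w = (\<Sum>b\<in>B. f b *\<^sub>R b)"
  have w: "w \<in> V" unfolding VB w_def by (intro span_sum span_scale span_base)
  have "w \<in> span (T ` B)"
  proof (rule ccontr)
    assume notin: "w \<notin> span (T ` B)"
    then have "w \<notin> T ` B" by (auto simp: span_base)
    moreover have "insert w (T ` B) \<subseteq> span B" using w TV VB by auto
    ultimately have "Suc (card B) \<le> card B"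
      using independent_span_bound[OF fin independent_insertI[OF notin indep]] fin card by simp
    then show False by simp
  qed
  moreover have "span (T ` B) \<subseteq> T ` V"
    using B(1) by (intro span_minimal linear_on_set_image_subspace[OF T_lin V(1)]) auto
  ultimately obtain q where q: "q \<in> V" "w = T q" by blast
  have "\<Omega> q b = f b" if "b \<in> B" for b
    using representation_combination[OF B(2) fin that, of "\<Omega> q"]
      representation_combination[OF B(2) fin that, of f] q(2) by (simp add: T_def w_def)
  then have "\<Omega> q v = f v" if "v \<in> V" for v by (intro eq_on_basis[OF \<Omega>_right[OF q(1)] f that])
  then show thesis using that q(1) by blast
qed

section \<open>Brackets and subalgebras\<close>

context lie_algebra
begin

lemma bracket_linear_right: "x \<in> G \<Longrightarrow> linear_on_set G (br x)"
  using bracket_bilinear by (simp add: bilinear_on_set_def)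

lemma bracket_linear_left: "y \<in> G \<Longrightarrow> linear_on_set G (\<lambda>x. br x y)"
  using bracket_bilinear by (simp add: bilinear_on_set_def)

lemma bracket_scale_right: "x \<in> G \<Longrightarrow> y \<in> G \<Longrightarrow> br x (c *\<^sub>R y) = c *\<^sub>R br x y"
  using bracket_linear_right by (simp add: linear_on_set_def)

lemma bracket_scale_left: "x \<in> G \<Longrightarrow> y \<in> G \<Longrightarrow> br (c *\<^sub>R x) y = c *\<^sub>R br x y"
  using bracket_linear_left by (simp add: linear_on_set_def)

lemma bracket_zero_right [simp]: "x \<in> G \<Longrightarrow> br x 0 = 0"
  using linear_on_set_zero[OF bracket_linear_right subspace_carrier] .

lemma bracket_zero_left [simp]: "x \<in> G \<Longrightarrow> br 0 x = 0"
  using linear_on_set_zero[OF bracket_linear_left subspace_carrier] .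

lemma bracket_diff_right: "x \<in> G \<Longrightarrow> y \<in> G \<Longrightarrow> z \<in> G \<Longrightarrow> br x (y - z) = br x y - br x z"
  using linear_on_set_diff[OF bracket_linear_right subspace_carrier] .

lemma zero_in_carrier [simp]: "0 \<in> G"
  by (rule subspace_0[OF subspace_carrier])

lemma bracket_minus_right: "x \<in> G \<Longrightarrow> y \<in> G \<Longrightarrow> br x (- y) = - br x y"
  using bracket_diff_right[of x 0 y] by simp

lemma bracket_leibniz:
  assumes "x \<in> G" "y \<in> G" "z \<in> G"
  shows "br x (br y z) = br (br x y) z + br y (br x z)"
proof -
  have 1: "br z (br x y) = - br (br x y) z"
    using assms by (intro bracket_skew bracket_closed)
  have 2: "br y (br z x) = - br y (br x z)"
    using assms bracket_skew[of z x] bracket_minus_right[of y "br x z"] by (simp add: bracket_closed)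
  show ?thesis using jacobi[OF assms] unfolding 1 2 by (simp add: algebra_simps)
qed

lemma bracket_span_subset:
  assumes "subspace U" "\<And>x y. x \<in> A \<Longrightarrow> y \<in> B \<Longrightarrow> br x y \<in> U"
  shows "bracket_span br A B \<subseteq> U"
  unfolding bracket_span_def by (rule span_minimal) (use assms in auto)

lemma bracket_span_base: "x \<in> A \<Longrightarrow> y \<in> B \<Longrightarrow> br x y \<in> bracket_span br A B"
  unfolding bracket_span_def by (rule span_base) blast

lemma subspace_bracket_span: "subspace (bracket_span br A B)"
  unfolding bracket_span_def by simp

lemma bracket_span_closed: "A \<subseteq> G \<Longrightarrow> B \<subseteq> G \<Longrightarrow> bracket_span br A B \<subseteq> G"
  by (rule bracket_span_subset[OF subspace_carrier]) (auto intro: bracket_closed)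

lemma bracket_closed_span:
  assumes "X \<subseteq> G" "\<And>x y. x \<in> X \<Longrightarrow> y \<in> X \<Longrightarrow> br x y \<in> span X" "x \<in> span X" "y \<in> span X"
  shows "br x y \<in> span X"
proof (rule linear_on_set_span[OF bracket_linear_left subspace_carrier subspace_span assms(1) _ assms(3)])
  show yG: "y \<in> G" using assms(1,4) span_minimal[OF _ subspace_carrier] by blast
  show "br x y \<in> span X" if "x \<in> X" for x
    by (rule linear_on_set_span[OF bracket_linear_right subspace_carrier subspace_span assms(1) _ assms(4)])
       (use that assms in auto)
qed

lemma lie_subalgebra_lie_algebra:
  assumes "lie_subalgebra G br H"
  shows "lie_algebra H br"
proof
  have H: "subspace H" "H \<subseteq> G" using assms by (auto simp: lie_subalgebra_def)
  show "subspace H" by (rule H(1))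
  show "\<exists>B. finite B \<and> H \<subseteq> span B" using finite_dimensional H(2) by blast
  show "bilinear_on_set H br" using bracket_bilinear H(2) by (rule bilinear_on_set_subset)
qed (use assms bracket_alternating jacobi in \<open>auto simp: lie_subalgebra_def subset_iff\<close>)

lemma radical_bracket_left: "r \<in> lie_radical G br \<Longrightarrow> x \<in> G \<Longrightarrow> br r x \<in> lie_radical G br"
  by (rule bracket_ideal_right[OF lie_radical_solvable_ideal(1)])

lemma radical_bracket_right: "x \<in> G \<Longrightarrow> r \<in> lie_radical G br \<Longrightarrow> br x r \<in> lie_radical G br"
  using lie_radical_solvable_ideal(1) by (simp add: lie_ideal_def)

lemma radical_subspace: "subspace (lie_radical G br)" "lie_radical G br \<subseteq> G"
  using lie_radical_solvable_ideal(1) by (simp_all add: lie_ideal_def)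

text \<open>
  The radical of a complement \<open>S\<close> plus the radical of \<open>G\<close> is again a solvable ideal of \<open>G\<close>:
  modulo the radical of \<open>G\<close>, brackets are computed in \<open>S\<close> alone.
\<close>

lemma radical_complement_semisimple:
  assumes S: "lie_subalgebra G br S" and sum: "internal_direct_sum G S (lie_radical G br)"
  shows "lie_semisimple S br"
proof -
  interpret S: lie_algebra S br by (rule lie_subalgebra_lie_algebra[OF S])
  let ?R = "lie_radical G br" and ?I = "lie_radical S br"
  let ?J = "{a + b | a b. a \<in> ?I \<and> b \<in> ?R}"
  note R = radical_subspace and I = S.radical_subspace
  have SG: "S \<subseteq> G" using S by (simp add: lie_subalgebra_def)
  have expand: "br (s + r) (s' + r') - br s s' \<in> ?R"
    if "s \<in> S" "r \<in> ?R" "s' \<in> S" "r' \<in> ?R" for s r s' r'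
  proof -
    have G: "s \<in> G" "r \<in> G" "s' \<in> G" "r' \<in> G" using that SG R(2) by auto
    then have "br (s + r) (s' + r') - br s s' = br s r' + br r (s' + r')"
      using subspace_add[OF subspace_carrier G(3,4)] by (simp add: bracket_add_left bracket_add_right)
    moreover have "br s r' \<in> ?R" "br r (s' + r') \<in> ?R"
      using that G subspace_add[OF subspace_carrier G(3,4)]
      by (auto intro: radical_bracket_left radical_bracket_right)
    ultimately show ?thesis using R(1) by (simp add: subspace_add)
  qed
  have J: "subspace ?J" by (intro subspace_sums R I)
  have "lie_ideal G br ?J"
    unfolding lie_ideal_def
  proof (intro conjI J ballI)
    show "?J \<subseteq> G"
    proof
      fix z assume "z \<in> ?J"
      then obtain a b where "z = a + b" "a \<in> ?I" "b \<in> ?R" by blast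
      then show "z \<in> G" using I(2) R(2) SG subspace_carrier by (auto intro!: subspace_add)
    qed
    fix x y assume "x \<in> G" "y \<in> ?J"
    then obtain s r a b where x: "x = s + r" "s \<in> S" "r \<in> ?R" and y: "y = a + b" "a \<in> ?I" "b \<in> ?R"
      using sum unfolding internal_direct_sum_def by blast
    then have "br x y - br s a \<in> ?R" using expand I(2) by blast
    moreover have "br s a \<in> ?I" using x y by (intro S.radical_bracket_right)
    moreover have "br x y = br s a + (br x y - br s a)" by simp
    ultimately show "br x y \<in> ?J" by blast
  qed
  moreover have "lie_solvable ?J br"
  proof -
    have step: "derived_series br ?J n \<subseteq> {a + b | a b. a \<in> derived_series br ?I n \<and> b \<in> ?R}" for n
    proof (induction n)
      case (Suc n)
      let ?D = "derived_series br ?I"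
      have D: "?D n \<subseteq> S" for n
        using S.derived_series_subset[OF I] S.radical_bracket_right I(2) by blast
      show ?case
        unfolding derived_series.simps(2)[of br ?J]
      proof (rule bracket_span_subset)
        show "subspace {a + b | a b. a \<in> ?D (Suc n) \<and> b \<in> ?R}"
          by (intro subspace_sums subspace_derived_series R I)
        fix x y assume "x \<in> derived_series br ?J n" "y \<in> derived_series br ?J n"
        then obtain a b a' b' where xy: "x = a + b" "a \<in> ?D n" "b \<in> ?R" "y = a' + b'" "a' \<in> ?D n" "b' \<in> ?R"
          using Suc.IH by blast
        then have "br x y - br a a' \<in> ?R" using expand D by blast
        moreover have "br a a' \<in> ?D (Suc n)" using xy by (auto intro: bracket_span_base)
        moreover have "br x y = br a a' + (br x y - br a a')" by simp
        ultimately show "br x y \<in> {a + b | a b. a \<in> ?D (Suc n) \<and> b \<in> ?R}" by blast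
      qed
    qed simp
    obtain n m where n: "derived_series br ?I n = {0}" and m: "derived_series br ?R m = {0}"
      using S.lie_radical_solvable_ideal(2) lie_radical_solvable_ideal(2) by (auto simp: lie_solvable_def)
    have "derived_series br ?J n \<subseteq> ?R" using step[of n] n by auto
    then have "derived_series br ?J (n + m) \<subseteq> {0}"
      unfolding derived_series_add using derived_series_mono m by blast
    moreover have "0 \<in> derived_series br ?J (n + m)"
      by (intro subspace_0 subspace_derived_series J)
    ultimately show ?thesis unfolding lie_solvable_def by blast
  qed
  ultimately have "?J \<subseteq> ?R" by (rule lie_radical_greatest)
  then have "?I \<subseteq> ?R" using subspace_0[OF R(1)] by force
  then have "?I \<subseteq> {0}" using sum I(2) unfolding internal_direct_sum_def by blast
  then show ?thesis using subspace_0[OF I(1)] by (auto simp: lie_semisimple_def)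
qed

end

section \<open>Sandwich elements and the nilpotent algebra they span\<close>

text \<open>
  The name is Kostrikin's: in the adjoint representation such a \<open>c\<close> satisfies \<open>c y c = 0\<close> for every
  \<open>y\<close>. This consequence is the second claim of \<open>sandwich_bracket_bracket\<close>.
\<close>

definition sandwich :: "'a::real_vector set \<Rightarrow> ('a \<Rightarrow> 'a \<Rightarrow> 'a) \<Rightarrow> 'a \<Rightarrow> bool" where
  "sandwich G br c \<longleftrightarrow> c \<in> G \<and> (\<forall>x\<in>G. br c (br c x) = 0)"

text \<open>
  Vanishing of some term says that all sufficiently long products of operators \<open>br b\<close> with
  \<open>b \<in> B\<close> are zero on \<open>V\<close>.
\<close>

primrec action_series ::
  "('a::real_vector \<Rightarrow> 'a \<Rightarrow> 'a) \<Rightarrow> 'a set \<Rightarrow> 'a set \<Rightarrow> nat \<Rightarrow> 'a set" where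
  "action_series br B V 0 = V"
| "action_series br B V (Suc n) = bracket_span br B (action_series br B V n)"

context lie_algebra
begin

text \<open>
  Expanding \<open>0 = [c, [c, [x, y]]]\<close> by the Leibniz rule leaves twice the first expression.
\<close>

lemma sandwich_bracket_bracket:
  assumes c: "sandwich G br c" and [simp]: "x \<in> G" "y \<in> G"
  shows "br (br c x) (br c y) = 0" "br c (br x (br c y)) = 0"
proof -
  have [simp]: "c \<in> G" and sq: "\<And>u. u \<in> G \<Longrightarrow> br c (br c u) = 0"
    using c by (auto simp: sandwich_def)
  have 1: "br c (br x (br c y)) = br (br c x) (br c y)"
    using bracket_leibniz[of c x "br c y"] by (simp add: sq bracket_closed)
  have 2: "br c (br (br c x) y) = br (br c x) (br c y)"
    using bracket_leibniz[of c "br c x" y] by (simp add: sq bracket_closed)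
  have "0 = br c (br c (br x y))" by (simp add: sq bracket_closed)
  also have "\<dots> = br c (br (br c x) y) + br c (br x (br c y))"
    by (simp add: bracket_leibniz[of c x y] bracket_add_right bracket_closed)
  also have "\<dots> = 2 *\<^sub>R br (br c x) (br c y)"
    unfolding 1 2 by (simp add: scaleR_2)
  finally show "br (br c x) (br c y) = 0" by simp
  then show "br c (br x (br c y)) = 0" by (simp add: 1)
qed

text \<open>
  The operator of \<open>[c, d]\<close> is \<open>c d - d c\<close>; each term of its square contains one of
  \<open>c c\<close>, \<open>d d\<close>, \<open>c d c\<close>, \<open>d c d\<close>.
\<close>

lemma sandwich_bracket:
  assumes c: "sandwich G br c" and d: "sandwich G br d"
  shows "sandwich G br (br c d)"
proof -
  have [simp]: "c \<in> G" "d \<in> G" using c d by (auto simp: sandwich_def)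
  have sq: "\<And>u. u \<in> G \<Longrightarrow> br c (br c u) = 0" "\<And>u. u \<in> G \<Longrightarrow> br d (br d u) = 0"
    using c d by (auto simp: sandwich_def)
  have ex: "br (br c d) u = br c (br d u) - br d (br c u)" if "u \<in> G" for u
    using bracket_leibniz[of c d u] that by simp
  have "br (br c d) (br (br c d) x) = 0" if [simp]: "x \<in> G" for x
    by (simp add: ex bracket_closed bracket_diff_right sq subspace_diff[OF subspace_carrier]
        sandwich_bracket_bracket[OF c] sandwich_bracket_bracket[OF d])
  then show ?thesis by (simp add: sandwich_def bracket_closed)
qed

lemma action_series_subset: "B \<subseteq> G \<Longrightarrow> subspace (action_series br B G n) \<and> action_series br B G n \<subseteq> G"
  by (induction n) (simp_all add: subspace_bracket_span subspace_carrier bracket_span_closed)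

lemma action_series_antimono:
  "B \<subseteq> G \<Longrightarrow> action_series br B G (Suc n) \<subseteq> action_series br B G n"
proof (induction n)
  case 0
  then show ?case using bracket_span_closed[of B G] by simp
next
  case (Suc n)
  then show ?case using bracket_span_mono[OF subset_refl Suc.IH[OF Suc.prems], where A = B and br = br] by simp
qed

lemma action_series_normalizer:
  assumes B: "B \<subseteq> G" and c: "c \<in> G" and norm: "\<And>b. b \<in> B \<Longrightarrow> br c b \<in> B"
    and x: "x \<in> action_series br B G n"
  shows "br c x \<in> action_series br B G n"
  using x
proof (induction n arbitrary: x)
  case 0
  then show ?case using c by (simp add: bracket_closed)
next
  case (Suc n)
  let ?S = "action_series br B G"
  have S: "subspace (?S n)" "?S n \<subseteq> G" for n using action_series_subset[OF B] by auto
  have "br c (br b s) \<in> ?S (Suc n)" if "b \<in> B" "s \<in> ?S n" for b s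
  proof -
    have "br c (br b s) = br (br c b) s + br b (br c s)"
      using that B S c by (intro bracket_leibniz) auto
    moreover have "br (br c b) s \<in> ?S (Suc n)" "br b (br c s) \<in> ?S (Suc n)"
      using that norm Suc.IH by (auto intro: bracket_span_base)
    ultimately show ?thesis using S(1)[of "Suc n"] by (simp only: subspace_add)
  qed
  note gen = this
  have x: "x \<in> span {br b s | b s. b \<in> B \<and> s \<in> ?S n}"
    using Suc.prems by (simp add: bracket_span_def)
  have A: "{br b s | b s. b \<in> B \<and> s \<in> ?S n} \<subseteq> G"
    using S(2)[of n] B by (auto intro!: bracket_closed)
  show ?case
    by (rule linear_on_set_span[OF bracket_linear_right[OF c] subspace_carrier S(1) A _ x])
       (use gen in blast)
qed

text \<open>
  Since \<open>c\<close> normalizes \<open>B\<close>, it preserves each term \<open>S\<^sub>n\<close> of the action series of \<open>B\<close>, and its square is zero.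
  Inserting \<open>S\<^sub>n\<^sub>+\<^sub>1 + c S\<^sub>n\<close> between \<open>S\<^sub>n\<close> and \<open>S\<^sub>n\<^sub>+\<^sub>1\<close> therefore gives a series that the enlarged
  algebra descends in twice as many steps.
\<close>

lemma action_series_insert_sandwich:
  assumes B: "subspace B" "B \<subseteq> G" and nil: "action_series br B G m \<subseteq> {0}"
    and c: "sandwich G br c" and norm: "\<And>b. b \<in> B \<Longrightarrow> br c b \<in> B"
  shows "action_series br (span (insert c B)) G (2 * m) \<subseteq> {0}"
proof -
  let ?S = "action_series br B G"
  let ?T = "\<lambda>n. {x + y | x y. x \<in> ?S (Suc n) \<and> y \<in> br c ` ?S n}"
  let ?B' = "span (insert c B)"
  have cG: "c \<in> G" and sq: "\<And>u. u \<in> G \<Longrightarrow> br c (br c u) = 0"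
    using c by (auto simp: sandwich_def)
  have S: "subspace (?S n)" "?S n \<subseteq> G" for n using action_series_subset[OF B(2)] by auto
  have cS: "br c x \<in> ?S n" if "x \<in> ?S n" for x n
    using action_series_normalizer[OF B(2) cG norm that] .
  have B'G: "insert c B \<subseteq> G" using cG B by blast
  have anti: "?S (Suc n) \<subseteq> ?S n" for n by (rule action_series_antimono[OF B(2)])
  have subT: "subspace (?T n)" for n
  proof -
    have "linear_on_set (?S n) (br c)"
      using bracket_linear_right[OF cG] S unfolding linear_on_set_def by blast
    then have "subspace (br c ` ?S n)"
      by (rule linear_on_set_image_subspace[OF _ S(1)])
    then show ?thesis by (intro subspace_sums S) auto
  qed
  have lift: "br b x \<in> U" if "b \<in> ?B'" "x \<in> G" "subspace U"
    "br c x \<in> U" "\<And>b. b \<in> B \<Longrightarrow> br b x \<in> U" for b x U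
    using linear_on_set_span[OF bracket_linear_left subspace_carrier that(3) B'G, of x b] that by auto
  have step1: "bracket_span br ?B' (?S n) \<subseteq> ?T n" for n
  proof (rule bracket_span_subset[OF subT])
    fix b' x assume b': "b' \<in> ?B'" and x: "x \<in> ?S n"
    show "br b' x \<in> ?T n"
    proof (rule lift[OF b' _ subT])
      show "x \<in> G" using x S(2) by auto
      show "br c x \<in> ?T n" using x subspace_0[OF S(1), of "Suc n"] by force
      fix b assume "b \<in> B"
      then have "br b x \<in> ?S (Suc n)" using x by (auto intro: bracket_span_base)
      moreover have "0 \<in> br c ` ?S n"
        using subspace_0[OF S(1), of n] bracket_zero_right[OF cG] by force
      ultimately show "br b x \<in> ?T n" by force
    qed
  qed
  have step2: "bracket_span br ?B' (?T n) \<subseteq> ?S (Suc n)" for n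
  proof (rule bracket_span_subset[OF S(1)])
    fix b' t assume b': "b' \<in> ?B'" and "t \<in> ?T n"
    then obtain x y where t: "t = x + br c y" "x \<in> ?S (Suc n)" "y \<in> ?S n" by auto
    have G: "x \<in> G" "y \<in> G" "br c y \<in> G"
      using t(2) S(2)[of "Suc n"] t(3) S(2)[of n] bracket_closed[OF cG] by blast+
    show "br b' t \<in> ?S (Suc n)"
    proof (rule lift[OF b' _ S(1)])
      show "t \<in> G" using t(1) G subspace_carrier by (simp add: subspace_add)
      have "br c t = br c x" using t(1) G cG by (simp add: bracket_add_right sq)
      then show "br c t \<in> ?S (Suc n)" using cS[OF t(2)] by simp
      fix b assume b: "b \<in> B"
      then have "br b t = br b x + br b (br c y)"
        unfolding t(1) using G B(2) by (intro bracket_add_right) auto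
      moreover have "br b x \<in> ?S (Suc n)"
        using b t(2) anti[of n] by (auto intro: bracket_span_base)
      moreover have "br b (br c y) \<in> ?S (Suc n)"
        using b cS[OF t(3)] by (auto intro: bracket_span_base)
      ultimately show "br b t \<in> ?S (Suc n)" using S(1)[of "Suc n"] by (simp only: subspace_add)
    qed
  qed
  have "action_series br ?B' G (2 * n) \<subseteq> ?S n" for n
  proof (induction n)
    case (Suc n)
    have "action_series br ?B' G (2 * Suc n)
        = bracket_span br ?B' (bracket_span br ?B' (action_series br ?B' G (2 * n)))" by simp
    also have "\<dots> \<subseteq> bracket_span br ?B' (?T n)"
      using bracket_span_mono[OF subset_refl Suc] step1[of n]
      by (intro bracket_span_mono) blast+
    also have "\<dots> \<subseteq> ?S (Suc n)" by (rule step2)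
    finally show ?case .
  qed simp
  then show ?thesis using nil by blast
qed

lemma solvable_if_action_nilpotent:
  assumes V: "subspace V" "V \<subseteq> G" "\<And>x y. x \<in> V \<Longrightarrow> y \<in> V \<Longrightarrow> br x y \<in> V"
    and nil: "action_series br V G m \<subseteq> {0}"
  shows "lie_solvable V br"
proof -
  have sub: "derived_series br V n \<subseteq> V" for n
    using V by (intro derived_series_subset) auto
  have "derived_series br V n \<subseteq> action_series br V G n" for n
  proof (induction n)
    case (Suc n)
    then show ?case using bracket_span_mono[OF sub Suc.IH, where br = br] by simp
  qed (use V in simp)
  then have "derived_series br V m \<subseteq> {0}" using nil by blast
  moreover have "0 \<in> derived_series br V m"
    by (intro subspace_0 subspace_derived_series V)
  ultimately show ?thesis unfolding lie_solvable_def by blast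
qed

text \<open>
  An Engel--Jacobson argument. Take a maximal nilpotently acting subalgebra \<open>B\<close> spanned by sandwich
  elements. If some sandwich element lay outside, bracketing it repeatedly with generators of \<open>B\<close>
  would have to enter \<open>B\<close> at some point because \<open>B\<close> acts nilpotently; the last one outside
  normalizes \<open>B\<close>, and adjoining it contradicts maximality.
\<close>

lemma sandwich_span_nilpotent:
  defines "C \<equiv> {c. sandwich G br c}"
  obtains m where "action_series br (span C) G m \<subseteq> {0}"
    "\<And>x y. x \<in> span C \<Longrightarrow> y \<in> span C \<Longrightarrow> br x y \<in> span C"
proof -
  have CG: "C \<subseteq> G" by (auto simp: C_def sandwich_def)
  have CC: "br c d \<in> C" if "c \<in> C" "d \<in> C" for c d
    using that sandwich_bracket by (simp add: C_def)
  obtain F where F: "finite F" "G \<subseteq> span F" using finite_dimensional by blast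
  define P where "P B \<longleftrightarrow> (\<exists>X\<subseteq>C. B = span X) \<and> (\<forall>x\<in>B. \<forall>y\<in>B. br x y \<in> B) \<and>
    (\<exists>m. action_series br B G m \<subseteq> {0})" for B
  have PG: "subspace B \<and> B \<subseteq> G" if "P B" for B
    using that CG span_minimal[OF _ subspace_carrier] unfolding P_def by force
  have "action_series br {0} G 1 \<subseteq> {0}"
    unfolding One_nat_def action_series.simps by (rule bracket_span_subset) auto
  then have "\<exists>m. action_series br {0} G m \<subseteq> {0}" by blast
  then have "P {0}" unfolding P_def by (simp add: exI[of _ "{}"])
  then obtain B where B: "P B" and max: "\<And>B'. P B' \<Longrightarrow> B \<subseteq> B' \<Longrightarrow> B' = B"
    using maximal_subspace_exists[OF F(1), of P "{0}"] PG F(2) by blast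
  have BG: "subspace B" "B \<subseteq> G" using PG[OF B] by auto
  obtain X m where X: "X \<subseteq> C" "B = span X" and closed: "\<And>x y. x \<in> B \<Longrightarrow> y \<in> B \<Longrightarrow> br x y \<in> B"
    and m: "action_series br B G m \<subseteq> {0}" using B unfolding P_def by blast
  have XB: "X \<subseteq> B" using X(2) span_superset by blast
  have "C \<subseteq> B"
  proof (rule ccontr)
    assume "\<not> C \<subseteq> B"
    have "\<exists>c\<in>C - B. \<forall>x\<in>X. br x c \<in> B"
    proof (rule ccontr)
      assume "\<not> ?thesis"
      then have bad: "\<And>c. c \<in> C - B \<Longrightarrow> \<exists>x\<in>X. br x c \<notin> B" by blast
      \<comment> \<open>Otherwise one can bracket with generators of \<open>B\<close> forever without entering \<open>B\<close>,
        while descending the action series, which reaches zero.\<close>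
      have "\<exists>c\<in>C - B. c \<in> action_series br B G k" for k
      proof (induction k)
        case 0
        then show ?case using \<open>\<not> C \<subseteq> B\<close> CG by auto
      next
        case (Suc k)
        then obtain c where c: "c \<in> C - B" "c \<in> action_series br B G k" by blast
        then obtain x where x: "x \<in> X" "br x c \<notin> B" using bad by blast
        then have "br x c \<in> action_series br B G (Suc k)" "br x c \<in> C"
          using c X(1) XB CC by (auto intro: bracket_span_base)
        then show ?case using x by blast
      qed
      then obtain c where "c \<in> C - B" "c \<in> action_series br B G m" by blast
      then show False using m subspace_0[OF BG(1)] by auto
    qed
    then obtain c where c: "c \<in> C" "c \<notin> B" and cX: "\<And>x. x \<in> X \<Longrightarrow> br x c \<in> B" by blast
    have cG: "c \<in> G" using c CG by blast
    have cB: "br c b \<in> B" if "b \<in> B" for b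
    proof (rule linear_on_set_span[OF bracket_linear_right[OF cG] subspace_carrier BG(1)])
      show "X \<subseteq> G" using XB BG by blast
      show "b \<in> span X" using that X(2) by simp
      fix x assume x: "x \<in> X"
      then have "br c x = - br x c" using XB BG cG by (intro bracket_skew) auto
      then show "br c x \<in> B" using cX[OF x] BG(1) by (simp add: subspace_neg)
    qed
    have Bc: "br b c \<in> B" if "b \<in> B" for b
    proof -
      have "br b c = - br c b" using that BG cG by (intro bracket_skew) auto
      then show ?thesis using cB[OF that] BG(1) by (simp add: subspace_neg)
    qed
    let ?B' = "span (insert c B)"
    have BB': "B \<subseteq> ?B'" using span_superset[of "insert c B"] by blast
    have "span (insert c X) = ?B'"
    proof
      show "span (insert c X) \<subseteq> ?B'" using XB by (intro span_mono) blast
      have "B \<subseteq> span (insert c X)" unfolding X(2) by (rule span_mono) blast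
      then show "?B' \<subseteq> span (insert c X)" by (intro span_minimal) (auto simp: span_base)
    qed
    then have "\<exists>X\<subseteq>C. ?B' = span X" using X(1) c(1) by (intro exI[of _ "insert c X"]) auto
    moreover have "br x y \<in> ?B'" if "x \<in> ?B'" "y \<in> ?B'" for x y
    proof (rule bracket_closed_span[OF _ _ that])
      show "insert c B \<subseteq> G" using cG BG by blast
      show "br x y \<in> ?B'" if "x \<in> insert c B" "y \<in> insert c B" for x y
        using that cB Bc closed BB' bracket_alternating[OF cG] by (auto simp: span_zero)
    qed
    moreover have "action_series br ?B' G (2 * m) \<subseteq> {0}"
      using c(1) cB by (intro action_series_insert_sandwich[OF BG m]) (simp_all add: C_def)
    ultimately have "P ?B'" unfolding P_def by blast
    then have "?B' = B" using max BB' by blast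
    then show False using c(2) span_base[of c "insert c B"] by simp
  qed
  then have "span C \<subseteq> B" using BG by (intro span_minimal)
  moreover have "B \<subseteq> span C" unfolding X(2) using X(1) by (rule span_mono)
  ultimately have "span C = B" by blast
  then show thesis using that m closed by simp
qed

end

section \<open>The span of the sandwich elements is an ideal\<close>

text \<open>
  By the Cauchy product the left-hand side is itself a power series in \<open>t\<close>, and the hypothesis
  is that its coefficients vanish.
\<close>

lemma power_series_bilinear_zero:
  fixes a :: "'b \<Rightarrow> nat \<Rightarrow> real"
  assumes summable: "\<And>b. b \<in> B \<Longrightarrow> summable (\<lambda>k. norm (a b k * t ^ k))"
    and zero: "\<And>n. (\<Sum>i\<le>n. \<Sum>b\<in>B. \<Sum>b'\<in>B. a b i * (a b' (n - i) * g b b')) = 0"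
  shows "(\<Sum>b\<in>B. \<Sum>b'\<in>B. (\<Sum>k. a b k * t ^ k) * ((\<Sum>k. a b' k * t ^ k) * g b b')) = 0"
proof -
  let ?c = "\<lambda>b b' n. (\<Sum>i\<le>n. (a b i * t ^ i) * (a b' (n - i) * t ^ (n - i))) * g b b'"
  have "?c b b' sums ((\<Sum>k. a b k * t ^ k) * ((\<Sum>k. a b' k * t ^ k) * g b b'))"
    if "b \<in> B" "b' \<in> B" for b b'
    using sums_mult2[OF Cauchy_product_sums[OF summable[OF that(1)] summable[OF that(2)]], of "g b b'"]
    by (simp add: mult.assoc)
  then have "(\<lambda>n. \<Sum>b\<in>B. \<Sum>b'\<in>B. ?c b b' n) sums
      (\<Sum>b\<in>B. \<Sum>b'\<in>B. (\<Sum>k. a b k * t ^ k) * ((\<Sum>k. a b' k * t ^ k) * g b b'))"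
    by (intro sums_sum)
  moreover have "(\<Sum>b\<in>B. \<Sum>b'\<in>B. ?c b b' n) = 0" for n
  proof -
    have "(a b i * t ^ i) * (a b' (n - i) * t ^ (n - i)) * g b b'
        = t ^ n * (a b i * (a b' (n - i) * g b b'))" if "i \<le> n" for b b' i
      using that power_add[of t i "n - i"] by (simp add: ac_simps)
    then have "(\<Sum>b\<in>B. \<Sum>b'\<in>B. ?c b b' n)
        = (\<Sum>b\<in>B. \<Sum>b'\<in>B. \<Sum>i\<le>n. t ^ n * (a b i * (a b' (n - i) * g b b')))"
      unfolding sum_distrib_right by (intro sum.cong refl) simp
    also have "\<dots> = (\<Sum>b\<in>B. \<Sum>i\<le>n. \<Sum>b'\<in>B. t ^ n * (a b i * (a b' (n - i) * g b b')))"
      by (intro sum.cong refl sum.swap)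
    also have "\<dots> = (\<Sum>i\<le>n. \<Sum>b\<in>B. \<Sum>b'\<in>B. t ^ n * (a b i * (a b' (n - i) * g b b')))"
      by (rule sum.swap)
    also have "\<dots> = t ^ n * (\<Sum>i\<le>n. \<Sum>b\<in>B. \<Sum>b'\<in>B. a b i * (a b' (n - i) * g b b'))"
      by (simp add: sum_distrib_left)
    finally show ?thesis by (simp add: zero)
  qed
  ultimately show ?thesis using sums_unique2[of "\<lambda>n. 0::real"] by fastforce
qed

lemma power_series_zero_coeff:
  fixes a :: "nat \<Rightarrow> real"
  assumes "\<And>t. summable (\<lambda>k. a k * t ^ k)" "\<And>t. (\<Sum>k. a k * t ^ k) = 0"
  shows "a 1 = 0"
proof -
  have "((\<lambda>t. \<Sum>k. a k * t ^ k) has_field_derivative (\<Sum>k. diffs a k * 0 ^ k)) (at 0)"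
    by (rule termdiffs_strong_converges_everywhere) (rule assms(1))
  then have "((\<lambda>t. 0) has_field_derivative a 1) (at (0::real))"
    by (simp add: assms(2) powser_zero diffs_def)
  then show ?thesis using DERIV_unique DERIV_const by blast
qed

context lie_algebra
begin

text \<open>
  With \<open>p k\<close> the coefficients of the formal flow \<open>exp(t ad y) c\<close>, this says that the flow stays
  among the sandwich elements order by order in \<open>t\<close>. Bracketing the identity of order \<open>n\<close> with
  \<open>y\<close> produces \<open>n + 1\<close> times the identity of order \<open>n + 1\<close>.
\<close>

lemma sandwich_flow_coefficients:
  assumes c: "sandwich G br c" and y: "y \<in> G" and v: "v \<in> G"
  defines "p \<equiv> \<lambda>k. (1 / fact k) *\<^sub>R (br y ^^ k) c"
  shows "(\<Sum>i\<le>n. br (p i) (br (p (n - i)) v)) = 0"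
proof -
  have cG: "c \<in> G" and sq: "\<And>u. u \<in> G \<Longrightarrow> br c (br c u) = 0" using c by (auto simp: sandwich_def)
  have pow: "(br y ^^ k) c \<in> G" for k by (induction k) (auto simp: cG y bracket_closed)
  have p: "p k \<in> G" for k using pow subspace_carrier by (simp add: p_def subspace_scale)
  have yp: "br y (p k) = real (Suc k) *\<^sub>R p (Suc k)" for k
    using y pow by (simp add: p_def bracket_scale_right divide_simps del: of_nat_Suc)
  show ?thesis using v
  proof (induction n arbitrary: v)
    case 0
    then show ?case using sq by (simp add: p_def)
  next
    case (Suc n)
    note v = \<open>v \<in> G\<close>
    let ?T = "\<lambda>i. br (p i) (br (p (Suc n - i)) v)"
    have in_G: "br (p i) (br (p j) u) \<in> G" if "u \<in> G" for i j u
      using p that by (intro bracket_closed)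
    have "0 = br y (\<Sum>i\<le>n. br (p i) (br (p (n - i)) v))
        - (\<Sum>i\<le>n. br (p i) (br (p (n - i)) (br y v)))"
      using Suc.IH v y by (simp add: bracket_closed)
    also have "br y (\<Sum>i\<le>n. br (p i) (br (p (n - i)) v))
        = (\<Sum>i\<le>n. br y (br (p i) (br (p (n - i)) v)))"
      using linear_on_set_sum[OF bracket_linear_right[OF y] subspace_carrier,
          where h = "\<lambda>_. 1" and S = "{..n}" and g = "\<lambda>i. br (p i) (br (p (n - i)) v)"] in_G[OF v]
      by simp
    also have "\<dots> - (\<Sum>i\<le>n. br (p i) (br (p (n - i)) (br y v)))
        = (\<Sum>i\<le>n. real (Suc i) *\<^sub>R ?T (Suc i) + real (Suc n - i) *\<^sub>R ?T i)"
      unfolding sum_subtractf[symmetric]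
    proof (rule sum.cong[OF refl])
      fix i assume "i \<in> {..n}"
      then have i: "Suc (n - i) = Suc n - i" by auto
      have "br y (br (p i) (br (p (n - i)) v))
          = br (br y (p i)) (br (p (n - i)) v)
            + br (p i) (br (br y (p (n - i))) v + br (p (n - i)) (br y v))"
        using y p v by (simp add: bracket_leibniz[of y] bracket_closed)
      also have "\<dots> = br (br y (p i)) (br (p (n - i)) v)
            + (br (p i) (br (br y (p (n - i))) v) + br (p i) (br (p (n - i)) (br y v)))"
        using y p v by (simp add: bracket_add_right bracket_closed)
      also have "br (br y (p i)) (br (p (n - i)) v) = real (Suc i) *\<^sub>R ?T (Suc i)"
        unfolding yp using p v by (simp add: bracket_scale_left bracket_closed del: of_nat_Suc)
      also have "br (p i) (br (br y (p (n - i))) v) = real (Suc n - i) *\<^sub>R ?T i"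
        unfolding yp i using p v
        by (simp add: bracket_scale_left bracket_scale_right bracket_closed del: of_nat_Suc)
      finally show "br y (br (p i) (br (p (n - i)) v)) - br (p i) (br (p (n - i)) (br y v))
          = real (Suc i) *\<^sub>R ?T (Suc i) + real (Suc n - i) *\<^sub>R ?T i"
        by simp
    qed
    also have "\<dots> = (\<Sum>i\<le>n. real (Suc i) *\<^sub>R ?T (Suc i)) + (\<Sum>i\<le>n. real (Suc n - i) *\<^sub>R ?T i)"
      by (rule sum.distrib)
    also have "(\<Sum>i\<le>n. real (Suc i) *\<^sub>R ?T (Suc i)) = (\<Sum>i\<le>Suc n. real i *\<^sub>R ?T i)"
      unfolding sum.atMost_Suc_shift by simp
    also have "(\<Sum>i\<le>n. real (Suc n - i) *\<^sub>R ?T i) = (\<Sum>i\<le>Suc n. real (Suc n - i) *\<^sub>R ?T i)"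
      by simp
    also have "(\<Sum>i\<le>Suc n. real i *\<^sub>R ?T i) + (\<Sum>i\<le>Suc n. real (Suc n - i) *\<^sub>R ?T i)
        = (\<Sum>i\<le>Suc n. real (Suc n) *\<^sub>R ?T i)"
      unfolding sum.distrib[symmetric] scaleR_add_left[symmetric]
      by (intro sum.cong refl) (simp add: of_nat_diff del: of_nat_Suc)
    finally have "real (Suc n) *\<^sub>R (\<Sum>i\<le>Suc n. ?T i) = 0" by (simp only: scaleR_sum_right)
    then show ?case by (simp del: sum.atMost_Suc of_nat_Suc)
  qed
qed

text \<open>
  Growth at most geometric makes the exponential series of \<open>ad y\<close> converge in coordinates.
\<close>

lemma iterated_bracket_coordinates_bounded:
  assumes B: "independent B" "finite B" "G = span B" and c: "c \<in> G" and y: "y \<in> G"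
  obtains K M where "\<And>k b. b \<in> B \<Longrightarrow> \<bar>representation B ((br y ^^ k) c) b\<bar> \<le> K * M ^ k"
proof -
  let ?r = "representation B"
  define N where "N x = (\<Sum>b\<in>B. \<bar>?r x b\<bar>)" for x
  define M where "M = (\<Sum>b\<in>B. N (br y b))"
  have N_nonneg: "0 \<le> N x" for x by (simp add: N_def sum_nonneg)
  have BG: "b \<in> G" if "b \<in> B" for b using that B(3) by (simp add: span_base)
  have step: "N (br y x) \<le> M * N x" if x: "x \<in> G" for x
  proof -
    have "?r (br y x) b' = (\<Sum>b\<in>B. ?r x b * ?r (br y b) b')" for b'
    proof -
      have "br y x = br y (\<Sum>b\<in>B. ?r x b *\<^sub>R b)"
        using basis_expansion[OF B(1,2), of x] x B(3) by simp
      also have "\<dots> = (\<Sum>b\<in>B. ?r x b *\<^sub>R br y b)"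
        using BG by (intro linear_on_set_sum[OF bracket_linear_right[OF y] subspace_carrier])
      also have "?r \<dots> b' = (\<Sum>b\<in>B. ?r x b *\<^sub>R ?r (br y b) b')"
        using bracket_closed[OF y] BG B(3)
        by (intro linear_on_set_sum[OF linear_on_set_representation[OF B(1)] subspace_span]) auto
      finally show ?thesis by simp
    qed
    then have "N (br y x) \<le> (\<Sum>b'\<in>B. \<Sum>b\<in>B. \<bar>?r x b\<bar> * \<bar>?r (br y b) b'\<bar>)"
      unfolding N_def by (auto intro!: sum_mono order_trans[OF sum_abs] simp: abs_mult)
    also have "\<dots> = (\<Sum>b\<in>B. \<bar>?r x b\<bar> * N (br y b))"
      unfolding N_def sum_distrib_left by (rule sum.swap)
    also have "\<dots> \<le> (\<Sum>b\<in>B. \<bar>?r x b\<bar> * M)"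
      unfolding M_def using B(2) N_nonneg
      by (intro sum_mono mult_left_mono) (auto intro: member_le_sum)
    finally show ?thesis by (simp add: N_def sum_distrib_left mult.commute)
  qed
  have M: "M \<ge> 0" by (simp add: M_def sum_nonneg N_nonneg)
  have pow: "(br y ^^ k) c \<in> G" for k by (induction k) (auto simp: c y bracket_closed)
  have "N ((br y ^^ k) c) \<le> N c * M ^ k" for k
  proof (induction k)
    case (Suc k)
    have "N ((br y ^^ Suc k) c) \<le> M * N ((br y ^^ k) c)" using step[OF pow] by simp
    also have "\<dots> \<le> M * (N c * M ^ k)" using Suc M by (rule mult_left_mono)
    finally show ?case by (simp add: ac_simps)
  qed simp
  moreover have "\<bar>?r x b\<bar> \<le> N x" if "b \<in> B" for x b
    unfolding N_def using that B(2) by (intro member_le_sum) auto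
  ultimately have "\<bar>?r ((br y ^^ k) c) b\<bar> \<le> N c * M ^ k" if "b \<in> B" for k b
    using that order_trans by blast
  then show thesis using that by blast
qed

text \<open>
  The curve \<open>e t = exp(t ad y) c\<close> consists of sandwich elements, and its derivative at \<open>0\<close> is
  \<open>[y, c]\<close>. As the ambient space carries no topology, the curve is built from convergent power
  series in coordinates. If \<open>[y, c]\<close> were outside the span of the sandwich elements, a basis could
  be chosen that contains it and a basis of that span; the coordinate along \<open>[y, c]\<close> then vanishes
  along the curve, although its linear coefficient is \<open>1\<close>.
\<close>

lemma sandwich_span_ideal:
  assumes c: "sandwich G br c" and y: "y \<in> G"
  shows "br y c \<in> span {c. sandwich G br c}" (is "_ \<in> span ?C")
proof (rule ccontr)
  assume notin: "br y c \<notin> span ?C"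
  have cG: "c \<in> G" using c by (simp add: sandwich_def)
  have CG: "?C \<subseteq> G" by (auto simp: sandwich_def)
  have pow: "(br y ^^ k) c \<in> G" for k by (induction k) (auto simp: cG y bracket_closed)
  define p where "p k = (1 / fact k) *\<^sub>R (br y ^^ k) c" for k
  have p: "p k \<in> G" for k using pow subspace_carrier by (simp add: p_def subspace_scale)
  obtain C\<^sub>0 where C\<^sub>0: "C\<^sub>0 \<subseteq> ?C" "independent C\<^sub>0" "?C \<subseteq> span C\<^sub>0"
    using maximal_independent_subset by blast
  have spanC: "span ?C = span C\<^sub>0"
    using C\<^sub>0 span_minimal[OF C\<^sub>0(3)] span_mono[OF C\<^sub>0(1)] by auto
  have p1: "p 1 = br y c" by (simp add: p_def)
  have "independent (insert (p 1) C\<^sub>0)"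
    by (rule independent_insertI[OF notin[unfolded spanC, folded p1] C\<^sub>0(2)])
  moreover have "insert (p 1) C\<^sub>0 \<subseteq> G" using p[of 1] C\<^sub>0(1) CG by blast
  ultimately obtain B where ext: "insert (p 1) C\<^sub>0 \<subseteq> B" and BG: "B \<subseteq> G" "independent B" "G \<subseteq> span B"
    using maximal_independent_subset_extend by metis
  have G: "G = span B" using BG(3) span_minimal[OF BG(1) subspace_carrier] by blast
  have fin: "finite B"
    using finite_dimensional independent_span_bound[OF _ BG(2)] BG(1) by blast
  let ?r = "representation B"
  have lin: "linear_on_set G (\<lambda>x. ?r x b)" for b
    unfolding G by (rule linear_on_set_representation[OF BG(2)])
  obtain K M where KM: "\<And>k b. b \<in> B \<Longrightarrow> \<bar>?r ((br y ^^ k) c) b\<bar> \<le> K * M ^ k"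
    using iterated_bracket_coordinates_bounded[OF BG(2) fin G cG y] by blast
  have rp: "?r (p k) b = ?r ((br y ^^ k) c) b / fact k" for k b
    unfolding p_def using lin[of b] pow[of k] by (simp add: linear_on_set_def)
  have summable: "summable (\<lambda>k. norm (?r (p k) b * t ^ k))" if "b \<in> B" for b t
  proof (rule summable_comparison_test[OF exI[of _ 0]])
    show "summable (\<lambda>k. K * ((M * \<bar>t\<bar>) ^ k /\<^sub>R fact k))"
      by (intro summable_mult summable_exp_generic)
    have "\<bar>?r ((br y ^^ k) c) b\<bar> * \<bar>t\<bar> ^ k / fact k \<le> K * M ^ k * \<bar>t\<bar> ^ k / fact k" for k
      using KM[OF that, of k] by (intro divide_right_mono mult_right_mono) auto
    then show "\<forall>n\<ge>0. norm (norm (?r (p n) b * t ^ n)) \<le> K * ((M * \<bar>t\<bar>) ^ n /\<^sub>R fact n)"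
      by (simp add: rp abs_mult power_abs power_mult_distrib divide_simps ac_simps)
  qed
  define e where "e t = (\<Sum>b\<in>B. (\<Sum>k. ?r (p k) b * t ^ k) *\<^sub>R b)" for t
  have eG: "e t \<in> G" for t
    unfolding e_def G by (intro span_sum span_scale span_base)
  have "br (e t) (br (e t) v) = 0" if v: "v \<in> G" for t v
  proof -
    have F: "?r (br (\<Sum>b\<in>B. f b *\<^sub>R b) (br (\<Sum>b\<in>B. h b *\<^sub>R b) v)) b\<^sub>0
        = (\<Sum>b\<in>B. \<Sum>b'\<in>B. f b * (h b' * ?r (br b (br b' v)) b\<^sub>0))" for f h b\<^sub>0
    proof -
      have in_G: "(\<Sum>b\<in>B. s b *\<^sub>R b) \<in> G" for s
        unfolding G by (intro span_sum span_scale span_base)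
      have "br (\<Sum>b\<in>B. h b *\<^sub>R b) v = (\<Sum>b\<in>B. h b *\<^sub>R br b v)"
        using BG(1) by (intro linear_on_set_sum[OF bracket_linear_left[OF v] subspace_carrier]) auto
      moreover have "br (\<Sum>b\<in>B. f b *\<^sub>R b) w = (\<Sum>b\<in>B. f b *\<^sub>R br b w)" if "w \<in> G" for w
        using BG(1) by (intro linear_on_set_sum[OF bracket_linear_left[OF that] subspace_carrier]) auto
      moreover have "br b (\<Sum>b'\<in>B. h b' *\<^sub>R br b' v) = (\<Sum>b'\<in>B. h b' *\<^sub>R br b (br b' v))" if "b \<in> B" for b
        using BG(1) v that
        by (intro linear_on_set_sum[OF bracket_linear_right subspace_carrier]) (auto intro: bracket_closed)
      ultimately have "br (\<Sum>b\<in>B. f b *\<^sub>R b) (br (\<Sum>b\<in>B. h b *\<^sub>R b) v)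
          = (\<Sum>b\<in>B. f b *\<^sub>R (\<Sum>b'\<in>B. h b' *\<^sub>R br b (br b' v)))"
        using bracket_closed[OF in_G v, of h] by simp
      also have "?r \<dots> b\<^sub>0 = (\<Sum>b\<in>B. f b *\<^sub>R ?r (\<Sum>b'\<in>B. h b' *\<^sub>R br b (br b' v)) b\<^sub>0)"
        using BG(1) v
        by (intro linear_on_set_sum[OF lin subspace_carrier] subspace_sum[OF subspace_carrier]
            subspace_scale[OF subspace_carrier]) (auto intro!: bracket_closed)
      also have "\<dots> = (\<Sum>b\<in>B. f b *\<^sub>R (\<Sum>b'\<in>B. h b' *\<^sub>R ?r (br b (br b' v)) b\<^sub>0))"
        using BG(1) v
        by (intro sum.cong refl arg_cong[where f = "scaleR _"] linear_on_set_sum[OF lin subspace_carrier])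
           (auto intro!: bracket_closed)
      finally show ?thesis by (simp add: sum_distrib_left)
    qed
    have exp_p: "(\<Sum>b\<in>B. ?r (p k) b *\<^sub>R b) = p k" for k
      using basis_expansion[OF BG(2) fin, of "p k"] p G by simp
    have "?r (br (e t) (br (e t) v)) b\<^sub>0 = 0" for b\<^sub>0
      unfolding e_def F
    proof (rule power_series_bilinear_zero[OF summable])
      fix n
      have "(\<Sum>i\<le>n. br (p i) (br (p (n - i)) v)) = 0"
        unfolding p_def by (rule sandwich_flow_coefficients[OF c y v])
      then have "0 = ?r (\<Sum>i\<le>n. 1 *\<^sub>R br (p i) (br (p (n - i)) v)) b\<^sub>0"
        using linear_on_set_zero[OF lin subspace_carrier] by simp
      also have "\<dots> = (\<Sum>i\<le>n. 1 *\<^sub>R ?r (br (p i) (br (p (n - i)) v)) b\<^sub>0)"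
        using p v by (intro linear_on_set_sum[OF lin subspace_carrier]) (auto intro!: bracket_closed)
      also have "\<dots> = (\<Sum>i\<le>n. \<Sum>b\<in>B. \<Sum>b'\<in>B. ?r (p i) b * (?r (p (n - i)) b' * ?r (br b (br b' v)) b\<^sub>0))"
        unfolding F[symmetric] exp_p by simp
      finally show "(\<Sum>i\<le>n. \<Sum>b\<in>B. \<Sum>b'\<in>B. ?r (p i) b * (?r (p (n - i)) b' * ?r (br b (br b' v)) b\<^sub>0)) = 0"
        by simp
    qed
    then have "(\<Sum>b\<in>B. ?r (br (e t) (br (e t) v)) b *\<^sub>R b) = 0" by simp
    then show ?thesis
      using basis_expansion[OF BG(2) fin, of "br (e t) (br (e t) v)"] bracket_closed eG v G by simp
  qed
  then have "sandwich G br (e t)" for t using eG by (simp add: sandwich_def)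
  then have eC: "e t \<in> span C\<^sub>0" for t using C\<^sub>0(3) by blast
  have pB: "p 1 \<in> B" using ext by blast
  have "?r (e t) (p 1) = 0" for t
  proof -
    have "?r x (p 1) = 0" if "x \<in> C\<^sub>0" for x
    proof -
      have "x \<noteq> p 1" using that notin p1 by (auto simp: spanC span_base)
      then show ?thesis using that ext by (subst representation_basis[OF BG(2)]) auto
    qed
    then have "?r (e t) (p 1) \<in> {0}"
      using C\<^sub>0(1) CG
      by (intro linear_on_set_span[OF lin subspace_carrier _ _ _ eC]) auto
    then show ?thesis by simp
  qed
  moreover have "?r (e t) (p 1) = (\<Sum>k. ?r (p k) (p 1) * t ^ k)" for t
    unfolding e_def by (rule representation_combination[OF BG(2) fin pB])
  ultimately have "(\<Sum>k. ?r (p k) (p 1) * t ^ k) = 0" for t by metis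
  then have "?r (p 1) (p 1) = 0"
    by (rule power_series_zero_coeff[OF summable_norm_cancel[OF summable[OF pB]]])
  then show False using representation_basis[OF BG(2) pB] by simp
qed

text \<open>
  The span of the sandwich elements is a solvable ideal.
\<close>

theorem sandwich_eq_zero:
  assumes "lie_radical G br = {0}" and c: "sandwich G br c"
  shows "c = 0"
proof -
  let ?V = "span {c. sandwich G br c}"
  have CG: "{c. sandwich G br c} \<subseteq> G" by (auto simp: sandwich_def)
  have V: "subspace ?V" "?V \<subseteq> G" using span_minimal[OF CG subspace_carrier] by auto
  obtain m where m: "action_series br ?V G m \<subseteq> {0}"
    and closed: "\<And>x y. x \<in> ?V \<Longrightarrow> y \<in> ?V \<Longrightarrow> br x y \<in> ?V"
    using sandwich_span_nilpotent by blast
  have "lie_ideal G br ?V"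
    unfolding lie_ideal_def
  proof (intro conjI V ballI)
    fix x v assume x: "x \<in> G" and v: "v \<in> ?V"
    show "br x v \<in> ?V"
      by (rule linear_on_set_span[OF bracket_linear_right[OF x] subspace_carrier V(1) CG _ v])
         (use sandwich_span_ideal x in blast)
  qed
  moreover have "lie_solvable ?V br" by (rule solvable_if_action_nilpotent[OF V closed m])
  ultimately have "?V \<subseteq> {0}" using lie_radical_greatest assms(1) by blast
  moreover have "c \<in> ?V" using c by (simp add: span_base)
  ultimately show ?thesis by blast
qed

end

section \<open>Symplectic symmetric triples\<close>

context symplectic_symmetric_triple
begin

text \<open>
  The image of the radical under the automorphism is again a solvable ideal.
\<close>

lemma radical_sigma:
  assumes "r \<in> lie_radical G br"
  shows "\<sigma> r \<in> lie_radical G br"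
proof -
  let ?R = "lie_radical G br"
  have img: "subspace (\<sigma> ` A)" if "subspace A" "A \<subseteq> G" for A
    using that by (intro linear_on_set_image_subspace linear_on_set_subset[OF sigma_linear])
  note R = radical_subspace
  have DR: "derived_series br ?R n \<subseteq> G" for n
    using derived_series_subset[OF R] radical_bracket_right R(2) by blast
  have "lie_ideal G br (\<sigma> ` ?R)"
    unfolding lie_ideal_def
  proof (intro conjI img R ballI)
    show "\<sigma> ` ?R \<subseteq> G" using R(2) sigma_closed by blast
    fix x y assume x: "x \<in> G" and "y \<in> \<sigma> ` ?R"
    then obtain s where s: "s \<in> ?R" "y = \<sigma> s" by blast
    have "br x y = \<sigma> (br (\<sigma> x) s)"
      using x s R(2) by (auto simp: sigma_bracket sigma_closed sigma_involutive)
    then show "br x y \<in> \<sigma> ` ?R" using radical_bracket_right[OF sigma_closed[OF x] s(1)] by blast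
  qed
  moreover have "lie_solvable (\<sigma> ` ?R) br"
  proof -
    have "derived_series br (\<sigma> ` ?R) n \<subseteq> \<sigma> ` derived_series br ?R n" for n
    proof (induction n)
      case (Suc n)
      show ?case
        unfolding derived_series.simps(2)[of br "\<sigma> ` ?R"]
      proof (rule bracket_span_subset[OF img[OF subspace_derived_series[OF R(1)] DR]])
        fix x y assume "x \<in> derived_series br (\<sigma> ` ?R) n" "y \<in> derived_series br (\<sigma> ` ?R) n"
        then obtain u v where uv: "x = \<sigma> u" "y = \<sigma> v" "u \<in> derived_series br ?R n" "v \<in> derived_series br ?R n"
          using Suc by blast
        then have "br x y = \<sigma> (br u v)" using subsetD[OF DR] by (simp add: sigma_bracket)
        moreover have "br u v \<in> derived_series br ?R (Suc n)" using uv by (auto intro: bracket_span_base)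
        ultimately show "br x y \<in> \<sigma> ` derived_series br ?R (Suc n)" by blast
      qed
    qed simp
    moreover obtain n where "derived_series br ?R n = {0}"
      using lie_radical_solvable_ideal(2) by (auto simp: lie_solvable_def)
    moreover have "\<sigma> 0 = 0" by (rule linear_on_set_zero[OF sigma_linear subspace_carrier])
    ultimately have "derived_series br (\<sigma> ` ?R) n \<subseteq> {0}" by fastforce
    moreover have "0 \<in> derived_series br (\<sigma> ` ?R) n"
      by (intro subspace_0 subspace_derived_series img R)
    ultimately show ?thesis unfolding lie_solvable_def by blast
  qed
  ultimately have "\<sigma> ` ?R \<subseteq> ?R" by (rule lie_radical_greatest)
  then show ?thesis using assms by blast
qed

abbreviation "K \<equiv> fixed_part \<sigma> G"
abbreviation "P \<equiv> anti_part \<sigma> G"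

lemma sigma_add: "x \<in> G \<Longrightarrow> y \<in> G \<Longrightarrow> \<sigma> (x + y) = \<sigma> x + \<sigma> y"
  using sigma_linear by (simp add: linear_on_set_def)

lemma sigma_scale: "x \<in> G \<Longrightarrow> \<sigma> (c *\<^sub>R x) = c *\<^sub>R \<sigma> x"
  using sigma_linear by (simp add: linear_on_set_def)

lemma K_G: "k \<in> K \<Longrightarrow> k \<in> G" and P_G: "p \<in> P \<Longrightarrow> p \<in> G"
  by (auto simp: fixed_part_def anti_part_def)

lemma K_P_zero:
  assumes "x \<in> K" "x \<in> P"
  shows "x = 0"
proof -
  have "x = - x" using assms by (auto simp: fixed_part_def anti_part_def)
  then have "2 *\<^sub>R x = 0" unfolding scaleR_2 by (metis add.right_inverse)
  then show ?thesis by simp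
qed

lemma subspace_K: "subspace K"
  unfolding subspace_def fixed_part_def
  using linear_on_set_zero[OF sigma_linear subspace_carrier] subspace_carrier
  by (auto simp: sigma_add sigma_scale subspace_add subspace_scale)

lemma subspace_P: "subspace P"
  unfolding subspace_def anti_part_def
  using linear_on_set_zero[OF sigma_linear subspace_carrier] subspace_carrier
  by (auto simp: sigma_add sigma_scale subspace_add subspace_scale)

lemma bracket_K_P: "k \<in> K \<Longrightarrow> p \<in> P \<Longrightarrow> br k p \<in> P"
  by (auto simp: fixed_part_def anti_part_def bracket_closed sigma_bracket bracket_minus_right)

lemma bracket_P_P: "p \<in> P \<Longrightarrow> q \<in> P \<Longrightarrow> br p q \<in> K"
  using bracket_span_base[of p P q P] by (simp add: bracket_anti_part)

lemma canonical_decomposition: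
  assumes V: "subspace V" "V \<subseteq> G" "\<And>v. v \<in> V \<Longrightarrow> \<sigma> v \<in> V" and x: "x \<in> V"
  obtains k p where "x = k + p" "k \<in> K" "k \<in> V" "p \<in> P" "p \<in> V"
proof
  have xG: "x \<in> G" "\<sigma> x \<in> V" "\<sigma> x \<in> G" using V x by blast+
  let ?k = "(1/2) *\<^sub>R (x + \<sigma> x)" and ?p = "(1/2) *\<^sub>R (x + (-1) *\<^sub>R \<sigma> x)"
  show V': "?k \<in> V" "?p \<in> V"
    by (intro subspace_scale[OF V(1)] subspace_add[OF V(1)] x xG)+
  have "\<sigma> ?k = (1/2) *\<^sub>R (\<sigma> x + x)"
    using xG subspace_add[OF subspace_carrier xG(1,3)]
    by (simp add: sigma_scale sigma_add sigma_involutive)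
  then show "?k \<in> K" using V' V(2) by (auto simp: fixed_part_def add.commute)
  have "\<sigma> ?p = (1/2) *\<^sub>R (\<sigma> x + (-1) *\<^sub>R x)"
    using xG subspace_scale[OF subspace_carrier xG(3), of "-1"]
      subspace_add[OF subspace_carrier xG(1) subspace_scale[OF subspace_carrier xG(3), of "-1"]]
    by (simp only: sigma_scale sigma_add sigma_involutive)
  then show "?p \<in> P" using V' V(2) by (auto simp: anti_part_def algebra_simps)
  show "x = ?k + ?p" unfolding scaleR_add_right[symmetric] by (simp add: scaleR_half_double)
qed

lemma form_left: "y \<in> P \<Longrightarrow> linear_on_set P (\<lambda>x. \<Omega> x y)"
  and form_right: "x \<in> P \<Longrightarrow> linear_on_set P (\<Omega> x)"
  using symplectic by (auto simp: symplectic_on_def bilinear_on_set_def)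

lemma form_skew:
  assumes "x \<in> P" "y \<in> P"
  shows "\<Omega> x y = - \<Omega> y x"
proof -
  have xy: "x + y \<in> P" using assms subspace_P by (simp add: subspace_add)
  have alt: "\<Omega> z z = 0" if "z \<in> P" for z using symplectic that by (simp add: symplectic_on_def)
  have "0 = \<Omega> (x + y) (x + y)" using alt[OF xy] by simp
  also have "\<dots> = \<Omega> x (x + y) + \<Omega> y (x + y)"
    using form_left[OF xy] assms by (simp add: linear_on_set_def)
  also have "\<dots> = \<Omega> x x + \<Omega> x y + (\<Omega> y x + \<Omega> y y)"
    using form_right assms by (simp add: linear_on_set_def)
  finally show ?thesis using alt assms by simp
qed

end

section \<open>Splitting off a symplectic radical\<close>

text \<open>
  In this locale \<open>S\<close> is shown to be a semisimple factor whose complement is the radical. Its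
  canonical decomposition has anti-invariant part \<open>W\<close> and invariant part \<open>K\<^sub>S\<close>.
\<close>

locale symplectic_radical_triple = symplectic_symmetric_triple +
  assumes radical_symplectic: "symplectic_on (anti_part \<sigma> G \<inter> lie_radical G br) \<Omega>"
begin

abbreviation "R \<equiv> lie_radical G br"

definition "W = {w \<in> P. \<forall>x\<in>P \<inter> R. \<Omega> x w = 0}"

definition "K\<^sub>S = bracket_span br W W"

definition "S = {w + k | w k. w \<in> W \<and> k \<in> K\<^sub>S}"

lemma W_P: "w \<in> W \<Longrightarrow> w \<in> P"
  by (simp add: W_def)

lemma W_G: "w \<in> W \<Longrightarrow> w \<in> G"
  by (simp add: W_P P_G)

lemma R_G: "r \<in> R \<Longrightarrow> r \<in> G"
  using radical_subspace(2) by blast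

lemma W_orthogonal: "w \<in> W \<Longrightarrow> x \<in> P \<Longrightarrow> x \<in> R \<Longrightarrow> \<Omega> w x = 0"
  using form_skew[of w x] by (simp add: W_def)

lemma subspace_W: "subspace W"
proof -
  have "W = (\<Inter>x\<in>P \<inter> R. {w \<in> P. \<Omega> x w \<in> {0}}) \<inter> P" by (auto simp: W_def)
  moreover have "subspace {w \<in> P. \<Omega> x w \<in> {0}}" if "x \<in> P \<inter> R" for x
    using that by (intro linear_on_set_vimage_subspace form_right subspace_P) auto
  ultimately show ?thesis by (auto intro!: subspace_inter subspace_Inter subspace_P)
qed

lemma bracket_K_W: "k \<in> K \<Longrightarrow> w \<in> W \<Longrightarrow> br k w \<in> W"
  unfolding W_def
proof (intro CollectI conjI ballI)
  assume k: "k \<in> K" and w: "w \<in> {w \<in> P. \<forall>x\<in>P \<inter> R. \<Omega> x w = 0}"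
  show "br k w \<in> P" using k w bracket_K_P by blast
  fix x assume x: "x \<in> P \<inter> R"
  then have "br k x \<in> P \<inter> R"
    using k bracket_K_P radical_bracket_right K_G by blast
  then show "\<Omega> x (br k w) = 0" using invariant[OF k, of x w] x w by auto
qed

lemma W_inter_radical: "w \<in> W \<Longrightarrow> w \<in> R \<Longrightarrow> w = 0"
proof -
  assume w: "w \<in> W" "w \<in> R"
  then show "w = 0" using radical_symplectic W_P W_orthogonal by (simp add: symplectic_on_def)
qed

text \<open>
  Nondegeneracy on \<open>P \<inter> R\<close> provides an element \<open>q\<close> there that represents the restriction of
  \<open>\<Omega> p\<close>; then \<open>p - q\<close> is orthogonal to \<open>P \<inter> R\<close>.
\<close>

lemma P_decomposition:
  assumes p: "p \<in> P"
  obtains w x where "p = w + x" "w \<in> W" "x \<in> P" "x \<in> R"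
proof -
  let ?V = "P \<inter> R"
  obtain F where F: "finite F" "G \<subseteq> span F" using finite_dimensional by blast
  have V: "subspace ?V" by (intro subspace_inter subspace_P radical_subspace)
  have VF: "?V \<subseteq> span F" using F(2) P_G by blast
  have lin: "linear_on_set ?V (\<Omega> p)" using form_right[OF p] by (rule linear_on_set_subset) blast
  have bil: "bilinear_on_set ?V \<Omega>" and nondeg: "\<And>x. x \<in> ?V \<Longrightarrow> \<forall>y\<in>?V. \<Omega> x y = 0 \<Longrightarrow> x = 0"
    using radical_symplectic by (auto simp: symplectic_on_def)
  obtain q where q: "q \<in> ?V" "\<And>v. v \<in> ?V \<Longrightarrow> \<Omega> q v = \<Omega> p v"
    using nondegenerate_form_represents[OF V VF F(1) bil nondeg lin] by blast
  have "p - q \<in> W"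
    unfolding W_def
  proof (intro CollectI conjI ballI)
    show pq: "p - q \<in> P" using p q subspace_P by (simp add: subspace_diff)
    fix x assume x: "x \<in> P \<inter> R"
    have "\<Omega> (p - q) x = \<Omega> p x - \<Omega> q x"
      using p q x by (intro linear_on_set_diff[OF form_left subspace_P]) auto
    then show "\<Omega> x (p - q) = 0" using q(2)[OF x] form_skew[of x "p - q"] pq x by simp
  qed
  then show thesis using that[of "p - q" q] q by simp
qed

lemma symplectic_W: "symplectic_on W \<Omega>"
  unfolding symplectic_on_def
proof (intro conjI ballI impI)
  show "bilinear_on_set W \<Omega>"
    using symplectic by (auto simp: symplectic_on_def intro: bilinear_on_set_subset W_P)
  show "\<Omega> w w = 0" if "w \<in> W" for w using symplectic that W_P by (simp add: symplectic_on_def)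
  fix w assume w: "w \<in> W" and zero: "\<forall>y\<in>W. \<Omega> w y = 0"
  have "\<Omega> w p = 0" if "p \<in> P" for p
  proof -
    obtain v x where p: "p = v + x" "v \<in> W" "x \<in> P" "x \<in> R"
      using P_decomposition[OF \<open>p \<in> P\<close>] .
    have "\<Omega> w p = \<Omega> w v + \<Omega> w x"
      using form_right[OF W_P[OF w]] p W_P by (simp add: linear_on_set_def)
    moreover have "\<Omega> w x = 0" using W_orthogonal[OF w p(3,4)] .
    ultimately show ?thesis using zero p by simp
  qed
  then show "w = 0" using symplectic W_P[OF w] by (simp add: symplectic_on_def)
qed

text \<open>
  The bracket lies in \<open>W\<close> by \<open>K\<close>-stability and in \<open>R\<close> since \<open>R\<close> is an ideal.
\<close>

lemma K_R_W_commute: "k \<in> K \<Longrightarrow> k \<in> R \<Longrightarrow> w \<in> W \<Longrightarrow> br k w = 0"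
  using bracket_K_W[of k w] radical_bracket_left[of k w] W_G W_inter_radical by blast

lemma W_K_R_commute:
  assumes "w \<in> W" "k \<in> K" "k \<in> R"
  shows "br w k = 0"
  using bracket_skew[of w k] K_R_W_commute[of k w] assms by (simp add: W_G R_G)

lemma K_S_K: "k \<in> K\<^sub>S \<Longrightarrow> k \<in> K"
proof -
  have "K\<^sub>S \<subseteq> K" unfolding K\<^sub>S_def by (intro bracket_span_subset subspace_K bracket_P_P W_P)
  then show "k \<in> K\<^sub>S \<Longrightarrow> k \<in> K" by blast
qed

lemma K_S_G: "k \<in> K\<^sub>S \<Longrightarrow> k \<in> G"
  using K_S_K K_G by blast

lemma subspace_K_S: "subspace K\<^sub>S"
  unfolding K\<^sub>S_def by (rule subspace_bracket_span)

text \<open>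
  For \<open>p \<in> P \<inter> R\<close> the element \<open>[w', p]\<close> lies in \<open>K \<inter> R\<close> and commutes with \<open>w\<close>, so both terms of
  \<open>[w, [w', p]] - [w', [w, p]]\<close> vanish; for elements of \<open>K \<inter> R\<close> already the inner brackets vanish.
\<close>

lemma K_S_radical_commute:
  assumes k: "k \<in> K\<^sub>S" and r: "r \<in> R"
  shows "br k r = 0"
proof -
  have gen: "br (br w w') r = 0" if w: "w \<in> W" "w' \<in> W" for w w'
  proof -
    obtain l p where r': "r = l + p" "l \<in> K" "l \<in> R" "p \<in> P" "p \<in> R"
      using canonical_decomposition[OF radical_subspace radical_sigma r] by metis
    note G = W_G[OF w(1)] W_G[OF w(2)] K_G[OF r'(2)] P_G[OF r'(4)]
    have "br (br w w') l = 0"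
      using bracket_leibniz[OF G(1,2,3)] W_K_R_commute[OF w(1) r'(2,3)] W_K_R_commute[OF w(2) r'(2,3)] G by simp
    moreover have "br (br w w') p = 0"
    proof -
      have "br v (br u p) = 0" if "u \<in> W" "v \<in> W" for u v
        using that r' bracket_P_P[OF W_P r'(4)] radical_bracket_right[OF W_G r'(5)]
        by (intro W_K_R_commute) auto
      then show ?thesis using bracket_leibniz[OF G(1,2,4)] w by simp
    qed
    ultimately show ?thesis using r' G bracket_add_right[of "br w w'" l p] by (simp add: bracket_closed)
  qed
  have A: "{br w w' | w w'. w \<in> W \<and> w' \<in> W} \<subseteq> G" by (auto intro!: bracket_closed intro: W_G)
  have k': "k \<in> span {br w w' | w w'. w \<in> W \<and> w' \<in> W}"
    using k by (simp add: K\<^sub>S_def bracket_span_def)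
  have "br k r \<in> {0}"
    by (rule linear_on_set_span[OF bracket_linear_left[OF R_G[OF r]] subspace_carrier _ A _ k'])
       (use gen in auto)
  then show ?thesis by simp
qed

lemma bracket_K_K_S:
  assumes "l \<in> K" "k \<in> K\<^sub>S"
  shows "br l k \<in> K\<^sub>S"
proof -
  have "br l (br w w') \<in> K\<^sub>S" if "w \<in> W" "w' \<in> W" for w w'
  proof -
    have "br l (br w w') = br (br l w) w' + br w (br l w')"
      using assms(1) that by (intro bracket_leibniz) (auto simp: K_G W_G)
    moreover have "br (br l w) w' \<in> K\<^sub>S" "br w (br l w') \<in> K\<^sub>S"
      using assms(1) that bracket_K_W unfolding K\<^sub>S_def by (auto intro: bracket_span_base)
    ultimately show ?thesis using subspace_K_S by (simp add: subspace_add)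
  qed
  note gen = this
  have A: "{br w w' | w w'. w \<in> W \<and> w' \<in> W} \<subseteq> G"
    by (auto intro!: bracket_closed intro: W_G)
  have k: "k \<in> span {br w w' | w w'. w \<in> W \<and> w' \<in> W}"
    using assms(2) by (simp add: K\<^sub>S_def bracket_span_def)
  show ?thesis
    by (rule linear_on_set_span[OF bracket_linear_right[OF K_G[OF assms(1)]] subspace_carrier
          subspace_K_S A _ k]) (use gen in blast)
qed

lemma S_subalgebra: "lie_subalgebra G br S"
  unfolding lie_subalgebra_def
proof (intro conjI ballI)
  show "subspace S" unfolding S_def by (intro subspace_sums subspace_W subspace_K_S)
  show "S \<subseteq> G" using subspace_carrier by (auto simp: S_def intro!: subspace_add[OF subspace_carrier] intro: W_G K_S_G)
  fix x y assume "x \<in> S" "y \<in> S"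
  then obtain w k w' k' where xy: "x = w + k" "w \<in> W" "k \<in> K\<^sub>S" "y = w' + k'" "w' \<in> W" "k' \<in> K\<^sub>S"
    unfolding S_def by blast
  note G = W_G[OF xy(2)] K_S_G[OF xy(3)] W_G[OF xy(5)] K_S_G[OF xy(6)]
  have "br x y = br w w' + br w k' + (br k w' + br k k')"
    unfolding xy using G subspace_add[OF subspace_carrier G(3,4)]
    by (simp add: bracket_add_left bracket_add_right)
  also have "br w k' = - br k' w" using G by (intro bracket_skew)
  also have "br w w' + - br k' w + (br k w' + br k k') = (br k w' - br k' w) + (br w w' + br k k')"
    by simp
  finally have "br x y = (br k w' - br k' w) + (br w w' + br k k')" .
  moreover have "br k w' - br k' w \<in> W"
    using xy K_S_K by (intro subspace_diff[OF subspace_W] bracket_K_W) auto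
  moreover have "br w w' \<in> K\<^sub>S" using xy unfolding K\<^sub>S_def by (intro bracket_span_base)
  then have "br w w' + br k k' \<in> K\<^sub>S"
    by (rule subspace_add[OF subspace_K_S _ bracket_K_K_S[OF K_S_K[OF xy(3)] xy(6)]])
  ultimately show "br x y \<in> S" unfolding S_def by blast
qed

sublocale S: lie_algebra S br
  by (rule lie_subalgebra_lie_algebra[OF S_subalgebra])

lemma W_S: "w \<in> W \<Longrightarrow> w \<in> S"
  unfolding S_def using subspace_0[OF subspace_K_S] by force

lemma K_S_S: "k \<in> K\<^sub>S \<Longrightarrow> k \<in> S"
  unfolding S_def using subspace_0[OF subspace_W] by force

lemma S_G: "x \<in> S \<Longrightarrow> x \<in> G"
  using S_subalgebra by (auto simp: lie_subalgebra_def)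

lemma sigma_S:
  assumes "w \<in> W" "k \<in> K\<^sub>S"
  shows "\<sigma> (w + k) = - w + k"
  using assms W_P[of w] K_S_K[of k] by (simp add: sigma_add W_G K_S_G fixed_part_def anti_part_def)

lemma fixed_part_S: "fixed_part \<sigma> S = K\<^sub>S"
proof
  show "K\<^sub>S \<subseteq> fixed_part \<sigma> S" using K_S_S K_S_K by (auto simp: fixed_part_def)
  show "fixed_part \<sigma> S \<subseteq> K\<^sub>S"
  proof
    fix x assume "x \<in> fixed_part \<sigma> S"
    then obtain w k where x: "x = w + k" "w \<in> W" "k \<in> K\<^sub>S" "\<sigma> x = x" by (auto simp: fixed_part_def S_def)
    then have "w = - w" using sigma_S[of w k] by simp
    then have "w \<in> K" using W_P[OF x(2)] W_G[OF x(2)] by (simp add: fixed_part_def anti_part_def)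
    then have "w = 0" using K_P_zero W_P[OF x(2)] by blast
    then show "x \<in> K\<^sub>S" using x by simp
  qed
qed

lemma anti_part_S: "anti_part \<sigma> S = W"
proof
  show "W \<subseteq> anti_part \<sigma> S" using W_S W_P by (auto simp: anti_part_def)
  show "anti_part \<sigma> S \<subseteq> W"
  proof
    fix x assume "x \<in> anti_part \<sigma> S"
    then obtain w k where x: "x = w + k" "w \<in> W" "k \<in> K\<^sub>S" "\<sigma> x = - x" by (auto simp: anti_part_def S_def)
    then have "k = - k" using sigma_S[of w k] by simp
    then have "k \<in> P" using K_S_K[OF x(3)] K_S_G[OF x(3)] by (simp add: fixed_part_def anti_part_def)
    then have "k = 0" using K_P_zero K_S_K[OF x(3)] by blast
    then show "x \<in> W" using x by simp
  qed
qed

text \<open>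
  Both components of such an element lie in \<open>R\<close>. The one in \<open>W\<close> is then zero, and the one in
  \<open>K\<^sub>S\<close> acts trivially on \<open>W\<close> and on \<open>P \<inter> R\<close>, hence on \<open>P\<close>, where \<open>K\<close> acts faithfully.
\<close>

lemma S_inter_radical:
  assumes x: "x \<in> S" "x \<in> R"
  shows "x = 0"
proof -
  obtain w k where wk: "x = w + k" "w \<in> W" "k \<in> K\<^sub>S" using x(1) by (auto simp: S_def)
  have "x + \<sigma> x \<in> R" using x(2) radical_sigma radical_subspace by (auto intro: subspace_add)
  moreover have "x + \<sigma> x = 2 *\<^sub>R k" using sigma_S[OF wk(2,3)] wk(1) by (simp add: scaleR_2)
  ultimately have "(1/2) *\<^sub>R (2 *\<^sub>R k) \<in> R" using radical_subspace(1) by (simp only: subspace_scale)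
  then have kR: "k \<in> R" by simp
  then have "x - k \<in> R" using x(2) radical_subspace(1) by (intro subspace_diff)
  then have w0: "w = 0" using W_inter_radical wk by simp
  have "br k p = 0" if p: "p \<in> P" for p
  proof -
    obtain v y where "p = v + y" "v \<in> W" "y \<in> P" "y \<in> R" using P_decomposition[OF p] .
    then show ?thesis
      using K_R_W_commute[OF K_S_K[OF wk(3)] kR] K_S_radical_commute[OF wk(3)] K_S_G[OF wk(3)]
      by (simp add: bracket_add_right W_G P_G)
  qed
  then have "k = 0" using faithful K_S_K[OF wk(3)] by blast
  then show ?thesis using w0 wk by simp
qed

text \<open>
  \<open>P = W + (P \<inter> R)\<close> lies in \<open>S + R\<close>, and so does \<open>K = [P, P]\<close>, since \<open>R\<close> is an ideal.
\<close>

lemma S_radical_sum: "internal_direct_sum G S R"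
  unfolding internal_direct_sum_def
proof
  have subS: "subspace S" using S_subalgebra by (simp add: lie_subalgebra_def)
  show "S \<inter> R = {0}"
    using S_inter_radical subspace_0[OF subS] subspace_0[OF radical_subspace(1)] by blast
  let ?T = "{a + b | a b. a \<in> S \<and> b \<in> R}"
  have T: "subspace ?T" by (intro subspace_sums subS radical_subspace)
  have ST: "x \<in> ?T" if "x \<in> S" for x using that subspace_0[OF radical_subspace(1)] by force
  have P: "p \<in> ?T" if p: "p \<in> P" for p
  proof -
    obtain v y where "p = v + y" "v \<in> W" "y \<in> P" "y \<in> R" using P_decomposition[OF p] .
    then show ?thesis using W_S by blast
  qed
  have "br p p' \<in> ?T" if pp: "p \<in> P" "p' \<in> P" for p p'
  proof -
    obtain v y where v: "p = v + y" "v \<in> W" "y \<in> P" "y \<in> R" using P_decomposition[OF pp(1)] .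
    obtain v' y' where v': "p' = v' + y'" "v' \<in> W" "y' \<in> P" "y' \<in> R" using P_decomposition[OF pp(2)] .
    have "br p p' = br v v' + (br v y' + br y p')"
      using v v' pp by (simp add: bracket_add_left bracket_add_right W_G P_G)
    moreover have "br v v' \<in> S" using v v' unfolding K\<^sub>S_def by (intro S.bracket_closed W_S)
    moreover have "br v y' + br y p' \<in> R"
      using v v' pp by (intro subspace_add[OF radical_subspace(1)] radical_bracket_left radical_bracket_right) (auto simp: W_G P_G)
    ultimately show ?thesis by blast
  qed
  then have K: "K \<subseteq> ?T" unfolding bracket_anti_part[symmetric] by (intro bracket_span_subset[OF T])
  show "G = ?T"
  proof
    show "G \<subseteq> ?T"
    proof
      fix x assume x: "x \<in> G"
      obtain k p where x: "x = k + p" "k \<in> K" "p \<in> P"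
        using canonical_decomposition[OF subspace_carrier _ sigma_closed x] by blast
      show "x \<in> ?T" unfolding x(1) by (rule subspace_add[OF T subsetD[OF K x(2)] P[OF x(3)]])
    qed
    show "?T \<subseteq> G" using subspace_carrier by (auto intro!: subspace_add[OF subspace_carrier] intro: S_G R_G)
  qed
qed

lemma S_semisimple: "lie_semisimple S br"
  by (rule radical_complement_semisimple[OF S_subalgebra S_radical_sum])

text \<open>
  Such a \<open>z\<close> is a sandwich element of \<open>S\<close>: \<open>[z, S]\<close> is contained in \<open>K\<^sub>S\<close>, which \<open>z\<close> annihilates.
\<close>

lemma K_S_invariant_zero:
  assumes z: "z \<in> W" and inv: "\<And>k. k \<in> K\<^sub>S \<Longrightarrow> br k z = 0"
  shows "z = 0"
proof (rule S.sandwich_eq_zero)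
  show "lie_radical S br = {0}" using S_semisimple by (simp add: lie_semisimple_def)
  have zk: "br z k = 0" if "k \<in> K\<^sub>S" for k
    using bracket_skew[of z k] inv[OF that] that z by (simp add: W_G K_S_G)
  show "sandwich S br z"
    unfolding sandwich_def
  proof (intro conjI ballI)
    show "z \<in> S" using z by (rule W_S)
    fix x assume "x \<in> S"
    then obtain w k where x: "x = w + k" "w \<in> W" "k \<in> K\<^sub>S" unfolding S_def by blast
    then have "br z x = br z w" using z zk by (simp add: bracket_add_right W_G K_S_G)
    moreover have "br z w \<in> K\<^sub>S" using z x unfolding K\<^sub>S_def by (intro bracket_span_base)
    ultimately show "br z (br z x) = 0" using zk by simp
  qed
qed

text \<open>
  For \<open>y, y' \<in> P \<inter> R\<close> the functional \<open>w \<mapsto> \<Omega>([[w, x], y], y')\<close> on \<open>W\<close> is \<open>K\<^sub>S\<close>-invariant, because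
  \<open>K\<^sub>S\<close> commutes with \<open>R\<close>. The vector that represents it is \<open>K\<^sub>S\<close>-invariant too, so it is zero.
  Thus \<open>[w, x] \<in> K \<inter> R\<close> kills \<open>P \<inter> R\<close>; as it kills \<open>W\<close> too, faithfulness applies.
\<close>

lemma W_P_R_commute:
  assumes w: "w \<in> W" and x: "x \<in> P" "x \<in> R"
  shows "br w x = 0"
proof -
  let ?f = "\<lambda>y y' w. \<Omega> (br (br w x) y) y'"
  have cK: "br w x \<in> K" "br w x \<in> R" if "w \<in> W" for w
    using that x by (auto intro: bracket_P_P W_P radical_bracket_right W_G)
  have f0: "?f y y' w = 0" if y: "y \<in> P \<inter> R" "y' \<in> P \<inter> R" and w: "w \<in> W" for y y' w
  proof -
    have G: "x \<in> G" "y \<in> G" "y' \<in> P" using x y P_G by auto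
    obtain F where F: "finite F" "G \<subseteq> span F" using finite_dimensional by blast
    have WF: "W \<subseteq> span F" using F(2) W_G by blast
    have lin: "linear_on_set W (?f y y')"
      unfolding linear_on_set_def
    proof (intro conjI ballI allI)
      fix u v assume u: "u \<in> W" and v: "v \<in> W"
      have P': "br (br u x) y \<in> P" "br (br v x) y \<in> P" using cK u v y by (auto intro: bracket_K_P)
      have "br (br (u + v) x) y = br (br u x) y + br (br v x) y"
        using u v G by (simp add: bracket_add_left bracket_closed W_G)
      then show "?f y y' (u + v) = ?f y y' u + ?f y y' v"
        using form_left[OF G(3)] P' by (simp add: linear_on_set_def)
    next
      fix c u assume u: "u \<in> W"
      have "br (br u x) y \<in> P" using cK u y by (auto intro: bracket_K_P)
      moreover have "br (br (c *\<^sub>R u) x) y = c *\<^sub>R br (br u x) y"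
        using u G by (simp add: bracket_scale_left bracket_closed W_G)
      ultimately show "?f y y' (c *\<^sub>R u) = c *\<^sub>R ?f y y' u"
        using form_left[OF G(3)] by (simp add: linear_on_set_def)
    qed
    have bil: "bilinear_on_set W \<Omega>" and nondeg: "\<And>x. x \<in> W \<Longrightarrow> \<forall>y\<in>W. \<Omega> x y = 0 \<Longrightarrow> x = 0"
      using symplectic_W by (auto simp: symplectic_on_def)
    obtain z where z: "z \<in> W" "\<And>v. v \<in> W \<Longrightarrow> \<Omega> z v = ?f y y' v"
      using nondegenerate_form_represents[OF subspace_W WF F(1) bil nondeg lin] by blast
    have "br k z = 0" if k: "k \<in> K\<^sub>S" for k
    proof (rule nondeg)
      show kz: "br k z \<in> W" using bracket_K_W[OF K_S_K[OF k] z(1)] .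
      show "\<forall>v\<in>W. \<Omega> (br k z) v = 0"
      proof
        fix v assume v: "v \<in> W"
        have kv: "br k v \<in> W" using bracket_K_W[OF K_S_K[OF k] v] .
        have "br k (br v x) = 0" "br k x = 0"
          using K_S_radical_commute[OF k] cK[OF v] x by auto
        then have "br (br k v) x = 0"
          using bracket_leibniz[of k v x] k v G by (simp add: K_S_G W_G)
        then have "\<Omega> z (br k v) = 0"
          using z(2)[OF kv] G form_left[OF G(3)] linear_on_set_zero[OF _ subspace_P] by simp
        then show "\<Omega> (br k z) v = 0"
          using invariant[OF K_S_K[OF k], of z v] z(1) v W_P by simp
      qed
    qed
    then have "z = 0" using K_S_invariant_zero z(1) by blast
    then show ?thesis
      using z(2)[OF w] linear_on_set_zero[OF form_left[OF W_P[OF w]] subspace_P] by simp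
  qed
  have "br (br w x) p = 0" if p: "p \<in> P" for p
  proof -
    obtain v y where p: "p = v + y" "v \<in> W" "y \<in> P" "y \<in> R"
      using P_decomposition[OF \<open>p \<in> P\<close>] .
    have "br (br w x) v = 0" using K_R_W_commute cK[OF w] p by blast
    moreover have "br (br w x) y \<in> P \<inter> R"
      using cK[OF w] p by (auto intro: bracket_K_P radical_bracket_right R_G)
    then have "br (br w x) y = 0"
      using f0[of y _ w] p w radical_symplectic by (auto simp: symplectic_on_def)
    ultimately show ?thesis
      using p cK[OF w] by (simp add: bracket_add_right R_G W_G)
  qed
  then show ?thesis using faithful cK[OF w] by blast
qed

lemma S_radical_commute:
  assumes "s \<in> S" "r \<in> R"
  shows "br s r = 0"
proof -
  obtain w k where s: "s = w + k" "w \<in> W" "k \<in> K\<^sub>S" using assms(1) by (auto simp: S_def)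
  obtain l p where r: "r = l + p" "l \<in> K" "l \<in> R" "p \<in> P" "p \<in> R"
    using canonical_decomposition[OF radical_subspace radical_sigma assms(2)] by metis
  have "br w r = br w l + br w p" using r s by (simp add: bracket_add_right W_G R_G)
  then have "br w r = 0" using W_K_R_commute W_P_R_commute r s by simp
  then show ?thesis
    using s K_S_radical_commute[OF s(3) assms(2)] assms(2) by (simp add: bracket_add_left W_G K_S_G R_G)
qed

text \<open>
  Because \<open>W\<close> and \<open>P \<inter> R\<close> commute, \<open>K = [P, P]\<close> is the sum of \<open>[W, W]\<close>, which meets \<open>R\<close> in \<open>0\<close>, and
  \<open>[P \<inter> R, P \<inter> R]\<close>.
\<close>

lemma K_radical: "K \<inter> R = bracket_span br (P \<inter> R) (P \<inter> R)"
proof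
  let ?D = "bracket_span br (P \<inter> R) (P \<inter> R)"
  show "?D \<subseteq> K \<inter> R"
    by (intro bracket_span_subset subspace_inter subspace_K radical_subspace)
       (auto intro: bracket_P_P radical_bracket_left P_G)
  let ?T = "{a + b | a b. a \<in> K\<^sub>S \<and> b \<in> ?D}"
  have T: "subspace ?T" by (intro subspace_sums subspace_K_S subspace_bracket_span)
  have "br p p' \<in> ?T" if pp: "p \<in> P" "p' \<in> P" for p p'
  proof -
    obtain v y where v: "p = v + y" "v \<in> W" "y \<in> P" "y \<in> R" using P_decomposition[OF pp(1)] .
    obtain v' y' where v': "p' = v' + y'" "v' \<in> W" "y' \<in> P" "y' \<in> R" using P_decomposition[OF pp(2)] .
    have "br v y' = 0" "br y v' = 0"
      using W_P_R_commute v v' bracket_skew[of y v'] by (auto simp: W_G P_G)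
    then have "br p p' = br v v' + br y y'"
      using v v' pp by (simp add: bracket_add_left bracket_add_right W_G P_G)
    moreover have "br v v' \<in> K\<^sub>S" using v v' unfolding K\<^sub>S_def by (intro bracket_span_base)
    moreover have "br y y' \<in> ?D" using v v' by (intro bracket_span_base) auto
    ultimately show ?thesis by blast
  qed
  then have K: "K \<subseteq> ?T" unfolding bracket_anti_part[symmetric] by (intro bracket_span_subset[OF T])
  show "K \<inter> R \<subseteq> ?D"
  proof
    fix k assume k: "k \<in> K \<inter> R"
    then obtain s r where sr: "k = s + r" "s \<in> K\<^sub>S" "r \<in> ?D" using K by blast
    then have "k - r \<in> R" using k \<open>?D \<subseteq> K \<inter> R\<close> by (intro subspace_diff[OF radical_subspace(1)]) auto
    then have "s = 0" using S_inter_radical K_S_S sr by simp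
    then show "k \<in> ?D" using sr by simp
  qed
qed

lemma radical_triple: "symplectic_symmetric_triple R br \<sigma> \<Omega>"
proof -
  have fixed: "fixed_part \<sigma> R = K \<inter> R" and anti: "anti_part \<sigma> R = P \<inter> R"
    using R_G by (auto simp: fixed_part_def anti_part_def)
  have "lie_subalgebra G br R"
    using radical_subspace radical_bracket_right by (auto simp: lie_subalgebra_def)
  then interpret R: lie_algebra R br by (rule lie_subalgebra_lie_algebra)
  show ?thesis
  proof
    show "linear_on_set R \<sigma>" using sigma_linear radical_subspace(2) by (rule linear_on_set_subset)
    fix k assume k: "k \<in> fixed_part \<sigma> R" and zero: "\<forall>p\<in>anti_part \<sigma> R. br k p = 0"
    have "br k p = 0" if p: "p \<in> P" for p
    proof -
      obtain v y where p: "p = v + y" "v \<in> W" "y \<in> P" "y \<in> R"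
      using P_decomposition[OF \<open>p \<in> P\<close>] .
      then show ?thesis
        using k zero K_R_W_commute by (simp add: fixed anti bracket_add_right K_G W_G P_G)
    qed
    then show "k = 0" using faithful k by (simp add: fixed)
  next
    fix k x y assume "k \<in> fixed_part \<sigma> R" "x \<in> anti_part \<sigma> R" "y \<in> anti_part \<sigma> R"
    then show "\<Omega> (br k x) y + \<Omega> x (br k y) = 0" using invariant by (simp add: fixed anti)
  qed (use radical_sigma R_G K_radical radical_symplectic in
      \<open>auto simp: fixed anti sigma_bracket sigma_involutive\<close>)
qed

lemma S_triple: "symplectic_symmetric_triple S br \<sigma> \<Omega>"
proof
  show "\<sigma> x \<in> S" if x: "x \<in> S" for x
  proof -
    obtain w k where "x = w + k" "w \<in> W" "k \<in> K\<^sub>S" using x by (auto simp: S_def)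
    then have "\<sigma> x = - w + k" "- w \<in> W" using sigma_S subspace_W by (auto simp: subspace_neg)
    then show ?thesis using \<open>k \<in> K\<^sub>S\<close> unfolding S_def by blast
  qed
  show "linear_on_set S \<sigma>" using sigma_linear by (rule linear_on_set_subset) (use S_G in blast)
  show "bracket_span br (anti_part \<sigma> S) (anti_part \<sigma> S) = fixed_part \<sigma> S"
    by (simp add: fixed_part_S anti_part_S K\<^sub>S_def)
  show "symplectic_on (anti_part \<sigma> S) \<Omega>" by (simp add: anti_part_S symplectic_W)
  fix k assume k: "k \<in> fixed_part \<sigma> S" and zero: "\<forall>p\<in>anti_part \<sigma> S. br k p = 0"
  have "br k p = 0" if p: "p \<in> P" for p
  proof -
    obtain v y where p: "p = v + y" "v \<in> W" "y \<in> P" "y \<in> R"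
      using P_decomposition[OF \<open>p \<in> P\<close>] .
    then show ?thesis
      using k zero K_S_radical_commute by (simp add: fixed_part_S anti_part_S bracket_add_right K_S_G W_G P_G)
  qed
  then show "k = 0" using faithful k K_S_K by (simp add: fixed_part_S)
next
  fix k x y assume "k \<in> fixed_part \<sigma> S" "x \<in> anti_part \<sigma> S" "y \<in> anti_part \<sigma> S"
  then show "\<Omega> (br k x) y + \<Omega> x (br k y) = 0"
    using invariant K_S_K W_P by (simp add: fixed_part_S anti_part_S)
qed (simp_all add: S_G sigma_bracket sigma_involutive)

theorem S_semisimple_factor: "semisimple_factor G br \<sigma> \<Omega> S"
  unfolding semisimple_factor_def triple_direct_sum_def
proof (intro exI[of _ R] conjI ballI)
  show "\<Omega> x y = 0" if "x \<in> anti_part \<sigma> S" "y \<in> anti_part \<sigma> R" for x y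
  proof -
    have "x \<in> W" using that(1) by (simp add: anti_part_S)
    moreover have "y \<in> P \<inter> R" using that(2) R_G by (auto simp: anti_part_def)
    ultimately show ?thesis by (simp add: W_orthogonal)
  qed
qed (auto intro: symplectic_symmetric_triple_axioms S_triple radical_triple S_radical_sum
      S_semisimple S_radical_commute)

end

section \<open>The maximal semisimple factor\<close>

context lie_algebra
begin

text \<open>
  The projection of the radical to \<open>A\<close> is a solvable ideal of \<open>A\<close>, hence zero, so the radical lies in
  \<open>B\<close>. Conversely, ideals of \<open>B\<close> are ideals of \<open>G\<close> because \<open>A\<close> commutes with them.
\<close>

lemma direct_sum_radical:
  assumes A: "lie_subalgebra G br A" and B: "lie_subalgebra G br B"
    and sum: "internal_direct_sum G A B" and commute: "\<And>a b. a \<in> A \<Longrightarrow> b \<in> B \<Longrightarrow> br a b = 0"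
    and ss: "lie_semisimple A br"
  shows "lie_radical B br = lie_radical G br"
proof
  interpret A: lie_algebra A br by (rule lie_subalgebra_lie_algebra[OF A])
  interpret B: lie_algebra B br by (rule lie_subalgebra_lie_algebra[OF B])
  let ?R = "lie_radical G br"
  have sub: "A \<subseteq> G" "B \<subseteq> G" using A B by (auto simp: lie_subalgebra_def)
  have commute': "br b a = 0" if "a \<in> A" "b \<in> B" for a b
    using bracket_skew[of b a] commute[OF that] sub that by auto
  have expand: "br (a + b) (a' + b') = br a a' + br b b'"
    if "a \<in> A" "b \<in> B" "a' \<in> A" "b' \<in> B" for a b a' b'
  proof -
    have G: "a \<in> G" "b \<in> G" "a' \<in> G" "b' \<in> G" using that sub by auto
    then have "br (a + b) (a' + b') = br a a' + br a b' + (br b a' + br b b')"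
      using subspace_add[OF subspace_carrier G(3,4)] by (simp add: bracket_add_left bracket_add_right)
    then show ?thesis using that by (simp add: commute commute')
  qed
  have "lie_ideal G br (lie_radical B br)"
    unfolding lie_ideal_def
  proof (intro conjI ballI B.radical_subspace)
    show "lie_radical B br \<subseteq> G" using B.radical_subspace(2) sub(2) by blast
    fix x y assume "x \<in> G" and y: "y \<in> lie_radical B br"
    then obtain a b where x: "x = a + b" "a \<in> A" "b \<in> B"
      using sum unfolding internal_direct_sum_def by blast
    have "y \<in> B" using y B.radical_subspace(2) by blast
    then have "br x y = br b y"
      using expand[OF x(2,3) A.zero_in_carrier, of y] x by simp
    then show "br x y \<in> lie_radical B br" using B.radical_bracket_right[OF x(3) y] by simp
  qed
  then show "lie_radical B br \<subseteq> ?R"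
    by (rule lie_radical_greatest[OF _ B.lie_radical_solvable_ideal(2)])
  let ?I = "\<lambda>D. {a \<in> A. \<exists>b\<in>B. a + b \<in> D}"
  have I: "subspace (?I D)" if D: "subspace D" for D
    unfolding subspace_def
  proof (intro conjI ballI allI)
    show "0 \<in> ?I D" using subspace_0[OF D] by (auto intro!: bexI[of _ 0])
    fix x assume "x \<in> ?I D"
    then obtain b where x: "x \<in> A" "b \<in> B" "x + b \<in> D" by blast
    show "c *\<^sub>R x \<in> ?I D" for c
      using x subspace_scale[OF D x(3), of c]
      by (auto simp: scaleR_add_right intro!: bexI[of _ "c *\<^sub>R b"] subspace_scale[OF A.subspace_carrier]
          subspace_scale[OF B.subspace_carrier])
    fix y assume "y \<in> ?I D"
    then obtain b' where y: "y \<in> A" "b' \<in> B" "y + b' \<in> D" by blast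
    have "(x + y) + (b + b') \<in> D" using subspace_add[OF D x(3) y(3)] by (simp add: ac_simps)
    then show "x + y \<in> ?I D"
      using subspace_add[OF A.subspace_carrier x(1) y(1)] subspace_add[OF B.subspace_carrier x(2) y(2)]
      by blast
  qed
  have "lie_ideal A br (?I ?R)"
    unfolding lie_ideal_def
  proof (intro conjI ballI I radical_subspace)
    fix x y assume x: "x \<in> A" and "y \<in> ?I ?R"
    then obtain b where y: "y \<in> A" "b \<in> B" "y + b \<in> ?R" by blast
    have "br x (y + b) = br x y + 0"
      using expand[OF x B.zero_in_carrier y(1,2)] y(2) by simp
    moreover have "br x (y + b) \<in> ?R" using radical_bracket_right x y(3) sub by blast
    ultimately have "br x y + 0 \<in> ?R" by simp
    then show "br x y \<in> ?I ?R" using A.bracket_closed[OF x y(1)] B.zero_in_carrier by blast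
  qed auto
  moreover have "lie_solvable (?I ?R) br"
  proof -
    have step: "derived_series br (?I ?R) n \<subseteq> ?I (derived_series br ?R n)" for n
    proof (induction n)
      case (Suc n)
      show ?case
        unfolding derived_series.simps(2)[of br "?I ?R"]
      proof (rule bracket_span_subset[OF I[OF subspace_derived_series[OF radical_subspace(1)]]])
        fix x y assume "x \<in> derived_series br (?I ?R) n" "y \<in> derived_series br (?I ?R) n"
        then obtain b b' where xy: "x \<in> A" "b \<in> B" "x + b \<in> derived_series br ?R n"
          "y \<in> A" "b' \<in> B" "y + b' \<in> derived_series br ?R n"
          using Suc by blast
        have "br (x + b) (y + b') \<in> derived_series br ?R (Suc n)"
          using xy by (auto intro: bracket_span_base)
        then have "br x y + br b b' \<in> derived_series br ?R (Suc n)"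
          by (simp only: expand[OF xy(1,2,4,5)])
        then show "br x y \<in> ?I (derived_series br ?R (Suc n))"
          using A.bracket_closed[OF xy(1,4)] B.bracket_closed[OF xy(2,5)] by blast
      qed
    qed simp
    obtain n where n: "derived_series br ?R n = {0}"
      using lie_radical_solvable_ideal(2) by (auto simp: lie_solvable_def)
    have "derived_series br (?I ?R) n \<subseteq> {0}"
    proof
      fix a assume "a \<in> derived_series br (?I ?R) n"
      then obtain b where a: "a \<in> A" "b \<in> B" "a + b = 0" using step[of n] n by auto
      then have "a = - b" by (simp add: eq_neg_iff_add_eq_0)
      then have "a \<in> A \<inter> B" using a subspace_neg[OF B.subspace_carrier a(2)] by simp
      then show "a \<in> {0}" using sum by (simp only: internal_direct_sum_def)
    qed
    moreover have "0 \<in> derived_series br (?I ?R) n"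
      by (intro subspace_0 subspace_derived_series I radical_subspace)
    ultimately show ?thesis unfolding lie_solvable_def by blast
  qed
  ultimately have "?I ?R \<subseteq> lie_radical A br" by (rule A.lie_radical_greatest)
  then have I0: "?I ?R \<subseteq> {0}" using ss by (simp only: lie_semisimple_def)
  have RB: "?R \<subseteq> B"
  proof
    fix r assume r: "r \<in> ?R"
    then obtain a b where ab: "r = a + b" "a \<in> A" "b \<in> B"
      using sum radical_subspace(2) unfolding internal_direct_sum_def by blast
    then have "a = 0" using I0 r by blast
    then show "r \<in> B" using ab by simp
  qed
  have "lie_ideal B br ?R"
    unfolding lie_ideal_def
    by (intro conjI ballI radical_subspace RB radical_bracket_right) (use sub in auto)
  then show "?R \<subseteq> lie_radical B br"
    by (rule B.lie_radical_greatest[OF _ lie_radical_solvable_ideal(2)])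
qed

end

theorem proposition4p1p6:
  fixes G L :: "'a::real_vector set"
    and br :: "'a \<Rightarrow> 'a \<Rightarrow> 'a"
    and \<sigma> :: "'a \<Rightarrow> 'a"
    and \<Omega> :: "'a \<Rightarrow> 'a \<Rightarrow> real"
  assumes "symplectic_symmetric_triple G br \<sigma> \<Omega>"
    and "\<not> lie_solvable G br"
    and "\<not> lie_semisimple G br"
    and "maximal_semisimple_factor G br \<sigma> \<Omega> L"
    and "symplectic_on (anti_part \<sigma> G \<inter> lie_radical G br) \<Omega>"
  shows "levi_factor G br L"
proof -
  obtain H where sum: "triple_direct_sum G br \<sigma> \<Omega> L H" and L: "lie_semisimple L br"
    and max: "\<And>M. semisimple_factor H br \<sigma> \<Omega> M \<Longrightarrow> M = {0}"
    using assms(4) unfolding maximal_semisimple_factor_def by blast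
  interpret G: symplectic_symmetric_triple G br \<sigma> \<Omega> by (rule assms(1))
  interpret L: symplectic_symmetric_triple L br \<sigma> \<Omega>
    using sum by (simp add: triple_direct_sum_def)
  interpret H: symplectic_symmetric_triple H br \<sigma> \<Omega>
    using sum by (simp add: triple_direct_sum_def)
  have LH: "internal_direct_sum G L H" and commute: "\<And>a b. a \<in> L \<Longrightarrow> b \<in> H \<Longrightarrow> br a b = 0"
    using sum by (auto simp: triple_direct_sum_def)
  have "L \<subseteq> G" "H \<subseteq> G"
    using LH L.zero_in_carrier H.zero_in_carrier unfolding internal_direct_sum_def by force+
  then have subalg: "lie_subalgebra G br L" "lie_subalgebra G br H"
    using L.subspace_carrier L.bracket_closed H.subspace_carrier H.bracket_closed
    by (auto simp: lie_subalgebra_def)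
  have rad: "lie_radical H br = lie_radical G br"
    using G.direct_sum_radical[OF subalg LH commute L] .
  have "anti_part \<sigma> H \<inter> lie_radical H br = anti_part \<sigma> G \<inter> lie_radical G br"
    using \<open>H \<subseteq> G\<close> H.radical_subspace(2) rad by (auto simp: anti_part_def)
  then interpret H: symplectic_radical_triple H br \<sigma> \<Omega>
    using assms(5) by unfold_locales simp
  have "H.S = {0}" by (rule max[OF H.S_semisimple_factor])
  then have "H = lie_radical H br"
    using H.S_radical_sum by (simp add: internal_direct_sum_def)
  then have "internal_direct_sum G L (lie_radical G br)" using LH rad by simp
  then show ?thesis using subalg(1) L by (simp add: levi_factor_def)
qed

end
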